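(* Let $E$ be a finite-dimensional Banach space, $C\subseteq E$ an open cone whose closure $\overline C$ is a proper cone, equipped with the Thompson metric $d_T$. Let $1\le p<\infty$ and $\mu_n,\nu\in\mathcal{P}^p(C)$ for $n\in\mathbb{N}$. (1) If $\mu_1\le\mu_2\le\cdots\le\nu$ in the stochastic order, then there exists $\mu\in\mathcal{P}^p(C)$ such that $\mu_n\le\mu\le\nu$ for all $n$ and $d_p^W(\mu_n,\mu)\to0$. (2) If $\mu_1\ge\mu_2\ge\cdots\ge\nu$ in the stochastic order, then there exists $\mu\in\mathcal{P}^p(C)$ such that $\mu_n\ge\mu\ge\nu$ for all $n$ and $d_p^W(\mu_n,\mu)\to0$.
   Context: $E$ is a real finite-dimensional Banach space and $C$ is a nonempty open (convex) cone in $E$; $\overline C$ proper means $\overline C\cap(-\overline C)=\{0\}$. The partial order on $E$ is $x\le y$ iff $y-x\in\overline C$, and $C$ carries its restriction. The Thompson metric on $C$ is $d_T(x,y)=\max\{\log M(x/y),\log M(y/x)\}$ with $M(x/y)=\inf\{\lambda>0:x\le\lambda y\}$; it is complete and induces on $C$ the topology inherited from $E$. $\mathcal{P}(C)$ denotes the set of all Borel probability measures on $C$ (in this separable setting they are all $\tau$-additive and inner regular). For $1\le p<\infty$, $\mathcal{P}^p(C)$ is the set of $\mu\in\mathcal{P}(C)$ with $\int_C d_T(x,y)^p\,d\mu(y)<\infty$ for some (equivalently every) $x\in C$, with the $p$-Wasserstein metric $d_p^W(\mu,\nu)=\bigl[\inf_{\pi\in\Pi(\mu,\nu)}\int_{C\times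 C}d_T(x,y)^p\,d\pi(x,y)\bigr]^{1/p}$, where $\Pi(\mu,\nu)$ is the set of $\pi\in\mathcal{P}(C\times C)$ with marginals $\mu$ and $\nu$. A subset $A\subseteq C$ is an upper set if $x\in A$, $y\in C$ and $x\le y$ imply $y\in A$. The stochastic order on $\mathcal{P}(C)$: $\mu\le\nu$ if $\mu(U)\le\nu(U)$ for each open upper set $U\subseteq C$. *)

theory Defs
  imports "HOL-Probability.Probability"
begin

(* The norm of a finite-dimensional Banach space is arbitrary, so euclidean_space, whose norm
   comes from an inner product, would be too special. The assumption says that a finite B has
   span B = UNIV, spelled out because the constant span is unavailable in a class specification. *)

class finite_dimensional_banach = banach +
  assumes finite_spanning_set:
    "\<exists>B. finite B \<and> (\<forall>x. \<exists>c. x = (\<Sum>b\<in>B. c b *\<^sub>R b))"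

instance euclidean_space \<subseteq> finite_dimensional_banach
  by standard (metis euclidean_representation finite_Basis)

(* The library's convex_cone requires closure under scaling by 0 as well. For an open set that would
   force C to be the whole space, so here only positive scalars are admitted. *)

definition open_cone :: "'a::real_normed_vector set \<Rightarrow> bool" where
  "open_cone C \<longleftrightarrow> C \<noteq> {} \<and> open C \<and> convex C \<and> (\<forall>x\<in>C. \<forall>t>0. t *\<^sub>R x \<in> C)"

definition proper_cone :: "'a::real_vector set \<Rightarrow> bool" where
  "proper_cone K \<longleftrightarrow> K \<inter> uminus ` K = {0}"

definition cone_le :: "'a::real_normed_vector set \<Rightarrow> 'a \<Rightarrow> 'a \<Rightarrow> bool" where
  "cone_le C x y \<longleftrightarrow> y - x \<in> closure C"

definition thompson_M :: "'a::real_normed_vector set \<Rightarrow> 'a \<Rightarrow> 'a \<Rightarrow> real" where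
  "thompson_M C x y = Inf {l. l > 0 \<and> cone_le C x (l *\<^sub>R y)}"

definition thompson_dist :: "'a::real_normed_vector set \<Rightarrow> 'a \<Rightarrow> 'a \<Rightarrow> real" where
  "thompson_dist C x y = max (ln (thompson_M C x y)) (ln (thompson_M C y x))"

definition borel_prob :: "'b::topological_space set \<Rightarrow> 'b measure set" where
  "borel_prob X = {\<mu>. prob_space \<mu> \<and> sets \<mu> = sets (restrict_space borel X)}"

definition borel_prob_p :: "real \<Rightarrow> 'a::real_normed_vector set \<Rightarrow> 'a measure set" where
  "borel_prob_p p C = {\<mu> \<in> borel_prob C.
     \<exists>x\<in>C. (\<integral>\<^sup>+y. ennreal (thompson_dist C x y powr p) \<partial>\<mu>) < \<infinity>}"

definition couplings ::
    "'a::real_normed_vector set \<Rightarrow> 'a measure \<Rightarrow> 'a measure \<Rightarrow> ('a \<times> 'a) measure set" where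
  "couplings C \<mu> \<nu> = {\<pi> \<in> borel_prob (C \<times> C).
     distr \<pi> (restrict_space borel C) fst = \<mu> \<and> distr \<pi> (restrict_space borel C) snd = \<nu>}"

(* For measures in borel_prob_p p C the product coupling has finite cost, so the infimum is finite
   and enn2real loses nothing. Outside that set an infinite infimum would be sent to 0. *)

definition wasserstein_dist ::
    "real \<Rightarrow> 'a::real_normed_vector set \<Rightarrow> 'a measure \<Rightarrow> 'a measure \<Rightarrow> real" where
  "wasserstein_dist p C \<mu> \<nu> =
     (enn2real (INF \<pi>\<in>couplings C \<mu> \<nu>.
        \<integral>\<^sup>+z. ennreal (thompson_dist C (fst z) (snd z) powr p) \<partial>\<pi>)) powr (1 / p)"

definition upper_set_in :: "'a::real_normed_vector set \<Rightarrow> 'a set \<Rightarrow> bool" where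
  "upper_set_in C A \<longleftrightarrow> A \<subseteq> C \<and> (\<forall>x\<in>A. \<forall>y\<in>C. cone_le C x y \<longrightarrow> y \<in> A)"

(* Since C is open, the relatively open subsets of C are the subsets that are open in the space. *)

definition stoch_le :: "'a::real_normed_vector set \<Rightarrow> 'a measure \<Rightarrow> 'a measure \<Rightarrow> bool" where
  "stoch_le C \<mu> \<nu> \<longleftrightarrow> (\<forall>U. open U \<and> upper_set_in C U \<longrightarrow> measure \<mu> U \<le> measure \<nu> U)"

end

theory Submission
  imports Defs
begin

text \<open>The masses \<open>M n U\<close> of open upper sets (open lower sets for a decreasing sequence) increase
  with \<open>n\<close>, so they converge on the ring generated by these sets. The limit is a countably additive
  content: open upper sets shrink by dilation, the complement of an open upper set is closed, and
  Thompson balls are compact, so ring sets are approximated from inside by compact sets. The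
  Caratheodory extension of the limit is the required measure \<open>\<mu>\<close>.

  The set \<open>{y. D x y > t}\<close> is the union of an upper and a lower set. Hence all measures between the
  two extreme ones have uniformly small \<open>p\<close>-th moments at infinity. A Thompson ball is covered by
  finitely many small order intervals in the ring, whose masses converge; transporting the common mass
  inside each cell and the small remainder by a product coupling shows that the Wasserstein distance
  tends to 0.\<close>

section \<open>Finite-dimensional Banach spaces\<close>

text \<open>Working with differences of up-sets makes convergence setwise: a half-open order
  interval is such a difference, so its mass converges without the null-boundary conditions of weak
  convergence. The price is that countable additivity of the limit has to be proved. Monotonicity in
  \<open>n\<close> is decisive there: on an open up-set the limit mass is a supremum over
  \<open>n\<close>, and it can be interchanged with the supremum over dilated up-sets. The
  complement of an open upper set is a closed lower set, not an open one. So even the equivalence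
  between comparing on open upper sets and comparing on open lower sets rests on dilation; the sign
  \<open>s\<close> then lets one argument serve both parts of the theorem. Finite dimension enters
  through the Heine-Borel property, derived for an arbitrary norm. It makes the cone normal, and
  normality bounds order intervals in norm. If 0 lies in \<open>C\<close>, the space is zero and the
  logarithms in the metric take default values; this case is treated apart.\<close>

lemma bounded_seq_in_finite_span:
  fixes X :: "nat \<Rightarrow> 'a::real_normed_vector"
  assumes "finite B" and "\<And>n. X n \<in> span B" and "bounded (range X)"
  shows "\<exists>l\<in>span B. \<exists>r::nat\<Rightarrow>nat. strict_mono r \<and> (X \<circ> r) \<longlonglongrightarrow> l"
  using assms
proof (induction B arbitrary: X rule: finite_induct)
  case empty
  then have "X = (\<lambda>n. 0)" by auto
  then show ?case
    by (intro bexI[of _ 0] exI[of _ id]) (auto simp: strict_mono_id o_def span_zero)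
next
  case (insert b B)
  show ?case
  proof (cases "b \<in> span B")
    case True
    then have "span (insert b B) = span B" by (rule span_redundant)
    then show ?thesis using insert by auto
  next
    case False
    \<comment> \<open>The induction hypothesis itself gives closedness: a convergent sequence is
      bounded, so a subsequence has its limit in the span. Hence \<open>b\<close> has positive
      distance from \<open>span B\<close>.\<close>
    have "closed (span B)"
      unfolding closed_sequential_limits
    proof (intro allI impI, elim conjE)
      fix Y :: "nat \<Rightarrow> 'a" and l assume Y: "\<forall>n. Y n \<in> span B" "Y \<longlonglongrightarrow> l"
      then obtain l' r where l': "l' \<in> span B" "strict_mono r" "(Y \<circ> r) \<longlonglongrightarrow> l'"
        using insert.IH[of Y] convergent_imp_bounded by blast
      then have "l = l'" using LIMSEQ_subseq_LIMSEQ[OF Y(2) l'(2)] LIMSEQ_unique by blast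
      then show "l \<in> span B" using l' by simp
    qed
    then have delta: "infdist b (span B) > 0" (is "?d > 0")
      using False in_closed_iff_infdist_zero[of "span B" b] span_zero[of B] infdist_nonneg[of b "span B"]
      by (metis empty_iff less_eq_real_def)
    have "\<forall>n. \<exists>k. X n - k *\<^sub>R b \<in> span B"
      using insert.prems(1) span_breakdown_eq by blast
    then obtain t where t: "\<And>n. X n - t n *\<^sub>R b \<in> span B" by metis
    have bd: "\<bar>t n\<bar> * ?d \<le> norm (X n)" for n
    proof (cases "t n = 0")
      case False
      \<comment> \<open>The factor is chosen so that this element differs from \<open>b\<close> by a
        multiple of \<open>X n\<close>; the distance of \<open>b\<close> from the span then bounds
        the coordinate \<open>t n\<close>.\<close>
      have "(- (1 / t n)) *\<^sub>R (X n - t n *\<^sub>R b) \<in> span B" using t by (rule span_scale)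
      then have "?d \<le> dist b ((- (1 / t n)) *\<^sub>R (X n - t n *\<^sub>R b))" by (rule infdist_le)
      also have "\<dots> = norm (X n) / \<bar>t n\<bar>"
        using False by (simp add: dist_norm scaleR_diff_right)
      finally show ?thesis using False by (simp add: field_simps)
    qed simp
    obtain K where K: "\<And>n. norm (X n) \<le> K" using insert.prems(2) by (auto simp: bounded_iff)
    have tb: "\<bar>t n\<bar> \<le> K / ?d" for n
      using bd[of n] K[of n] delta by (simp add: field_simps)
    then have "bounded (range t)" by (auto simp: bounded_iff)
    then obtain \<tau> and r1 :: "nat \<Rightarrow> nat" where r1: "strict_mono r1" "(t \<circ> r1) \<longlonglongrightarrow> \<tau>"
      using bounded_imp_convergent_subsequence by blast
    define Y where "Y n = X (r1 n) - t (r1 n) *\<^sub>R b" for n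
    have "norm (Y n) \<le> K + K / ?d * norm b" for n
    proof -
      have "norm (Y n) \<le> norm (X (r1 n)) + \<bar>t (r1 n)\<bar> * norm b"
        unfolding Y_def by (metis norm_scaleR norm_triangle_ineq4)
      also have "\<dots> \<le> K + K / ?d * norm b"
        by (intro add_mono mult_right_mono K tb) auto
      finally show ?thesis .
    qed
    then have "bounded (range Y)" by (auto simp: bounded_iff)
    moreover have "\<And>n. Y n \<in> span B" unfolding Y_def using t by blast
    ultimately obtain l r2 where r2: "l \<in> span B" "strict_mono r2" "(Y \<circ> r2) \<longlonglongrightarrow> l"
      using insert.IH by blast
    have "(\<lambda>n. (t \<circ> r1 \<circ> r2) n *\<^sub>R b + (Y \<circ> r2) n) \<longlonglongrightarrow> \<tau> *\<^sub>R b + l"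
      using LIMSEQ_subseq_LIMSEQ[OF r1(2) r2(2)] r2(3) by (intro tendsto_intros)
    then have "(X \<circ> (r1 \<circ> r2)) \<longlonglongrightarrow> \<tau> *\<^sub>R b + l"
      by (simp add: Y_def o_def)
    moreover have "strict_mono (r1 \<circ> r2)" using r1 r2 by (intro strict_mono_o)
    moreover have "\<tau> *\<^sub>R b + l \<in> span (insert b B)"
      using r2(1) by (simp add: span_breakdown_eq[of _ b] exI[of _ \<tau>])
    ultimately show ?thesis by blast
  qed
qed

instance finite_dimensional_banach \<subseteq> heine_borel
proof
  fix X :: "nat \<Rightarrow> 'a" assume X: "bounded (range X)"
  obtain B :: "'a set" where B: "finite B" "\<And>x. \<exists>c. x = (\<Sum>b\<in>B. c b *\<^sub>R b)"
    using finite_spanning_set by blast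
  have "x \<in> span B" for x
    using B(2)[of x] by (auto intro!: span_sum span_scale intro: span_base)
  then show "\<exists>l r. strict_mono (r::nat\<Rightarrow>nat) \<and> (X \<circ> r) \<longlonglongrightarrow> l"
    using bounded_seq_in_finite_span[OF B(1) _ X] by blast
qed

text \<open>Finite nets of the balls around 0 supply countably many small balls that form a base.
  Lindelof covers and the agreement of product and Borel sigma-algebras depend on this.\<close>

instance finite_dimensional_banach \<subseteq> second_countable_topology
proof
  have "\<exists>k. finite k \<and> cball (0::'a) (real n) \<subseteq> (\<Union>x\<in>k. ball x (1 / real (Suc m)))" for n m
  proof -
    have "\<forall>e>0. \<exists>k. finite k \<and> cball (0::'a) (real n) \<subseteq> (\<Union>x\<in>k. ball x e)"
      using compact_cball[of "0::'a" "real n"] unfolding compact_eq_totally_bounded by (rule conjunct2)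
    then show ?thesis by (rule allE[of _ "1 / real (Suc m)"]) simp
  qed
  then obtain k where k: "\<And>n m. finite (k n m)"
    "\<And>n m. cball (0::'a) (real n) \<subseteq> (\<Union>x\<in>k n m. ball x (1 / real (Suc m)))"
    by metis
  define \<B> where "\<B> = (\<Union>n m. (\<lambda>x. ball x (1 / real (Suc m))) ` k n m)"
  have "topological_basis \<B>"
  proof (rule topological_basisI)
    show "open b" if "b \<in> \<B>" for b using that by (auto simp: \<B>_def)
    fix U and x :: 'a assume "open U" "x \<in> U"
    then obtain e where e: "e > 0" "ball x e \<subseteq> U" using open_contains_ball by blast
    obtain n where n: "norm x \<le> real n" using real_arch_simple by blast
    obtain m' where "2 / e < real m'" using reals_Archimedean2 by blast
    then obtain m where m: "2 / e < real (Suc m)" by (intro that[of m']) simp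
    have "x \<in> cball 0 (real n)" using n by simp
    then obtain z where z: "z \<in> k n m" "x \<in> ball z (1 / real (Suc m))"
      using k(2)[of n m] by blast
    have "2 * (1 / real (Suc m)) < e" using m e(1) by (simp add: field_simps)
    then have "dist x y < e" if "dist z y < 1 / real (Suc m)" for y
      using dist_triangle3[of x y z] z(2) that unfolding mem_ball by linarith
    then have "ball z (1 / real (Suc m)) \<subseteq> ball x e" by auto
    then show "\<exists>B'\<in>\<B>. x \<in> B' \<and> B' \<subseteq> U"
      using z e(2) unfolding \<B>_def by blast
  qed
  moreover have "countable \<B>"
    unfolding \<B>_def by (intro countable_UN countable_image countableI_type countable_finite k(1))
  ultimately show "\<exists>B::'a set set. countable B \<and> open = generate_topology B"
    using topological_basis_imp_subbasis by blast
qed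

section \<open>Couplings along a partition\<close>

lemma distr_density_fst:
  fixes g :: "'a \<times> 'b \<Rightarrow> ennreal"
  assumes "prob_space m" "prob_space m'" and g[measurable]: "g \<in> borel_measurable (m \<Otimes>\<^sub>M m')"
    and AE: "AE x in m. (\<integral>\<^sup>+y. g (x, y) \<partial>m') = 1"
  shows "distr (density (m \<Otimes>\<^sub>M m') g) m fst = m"
proof (rule measure_eqI)
  interpret m: prob_space m by fact
  interpret m': prob_space m' by fact
  fix A assume "A \<in> sets (distr (density (m \<Otimes>\<^sub>M m') g) m fst)"
  then have A[measurable]: "A \<in> sets m" by simp
  have "emeasure (distr (density (m \<Otimes>\<^sub>M m') g) m fst) A
      = emeasure (density (m \<Otimes>\<^sub>M m') g) (fst -` A \<inter> space (m \<Otimes>\<^sub>M m'))"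
    by (subst emeasure_distr) auto
  also have "\<dots> = (\<integral>\<^sup>+z. g z * indicator (fst -` A \<inter> space (m \<Otimes>\<^sub>M m')) z \<partial>(m \<Otimes>\<^sub>M m'))"
    by (subst emeasure_density) auto
  also have "\<dots> = (\<integral>\<^sup>+z. g z * indicator A (fst z) \<partial>(m \<Otimes>\<^sub>M m'))"
    by (intro nn_integral_cong) (auto simp: indicator_def)
  also have "\<dots> = (\<integral>\<^sup>+x. \<integral>\<^sup>+y. g (x, y) * indicator A x \<partial>m' \<partial>m)"
    by (subst m'.nn_integral_fst[symmetric]) auto
  also have "\<dots> = (\<integral>\<^sup>+x. (\<integral>\<^sup>+y. g (x, y) \<partial>m') * indicator A x \<partial>m)"
    by (intro nn_integral_cong nn_integral_multc) measurable
  also have "\<dots> = (\<integral>\<^sup>+x. indicator A x \<partial>m)"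
    using AE by (intro nn_integral_cong_AE) auto
  finally show "emeasure (distr (density (m \<Otimes>\<^sub>M m') g) m fst) A = emeasure m A" by simp
qed simp

lemma distr_density_snd:
  fixes g :: "'a \<times> 'b \<Rightarrow> ennreal"
  assumes m: "prob_space m" and m': "prob_space m'" and g[measurable]: "g \<in> borel_measurable (m \<Otimes>\<^sub>M m')"
    and AE: "AE y in m'. (\<integral>\<^sup>+x. g (x, y) \<partial>m) = 1"
  shows "distr (density (m \<Otimes>\<^sub>M m') g) m' snd = m'"
proof (rule measure_eqI)
  interpret m: prob_space m by fact
  interpret m': prob_space m' by fact
  interpret pair_sigma_finite m m' ..
  fix A assume "A \<in> sets (distr (density (m \<Otimes>\<^sub>M m') g) m' snd)"
  then have A[measurable]: "A \<in> sets m'" by simp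
  have "emeasure (distr (density (m \<Otimes>\<^sub>M m') g) m' snd) A
      = emeasure (density (m \<Otimes>\<^sub>M m') g) (snd -` A \<inter> space (m \<Otimes>\<^sub>M m'))"
    by (subst emeasure_distr) auto
  also have "\<dots> = (\<integral>\<^sup>+z. g z * indicator (snd -` A \<inter> space (m \<Otimes>\<^sub>M m')) z \<partial>(m \<Otimes>\<^sub>M m'))"
    by (subst emeasure_density) auto
  also have "\<dots> = (\<integral>\<^sup>+z. g z * indicator A (snd z) \<partial>(m \<Otimes>\<^sub>M m'))"
    by (intro nn_integral_cong) (auto simp: indicator_def)
  also have "\<dots> = (\<integral>\<^sup>+y. \<integral>\<^sup>+x. g (x, y) * indicator A y \<partial>m \<partial>m')"
    by (subst nn_integral_snd[symmetric]) auto
  also have "\<dots> = (\<integral>\<^sup>+y. (\<integral>\<^sup>+x. g (x, y) \<partial>m) * indicator A y \<partial>m')"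
    by (intro nn_integral_cong nn_integral_multc) measurable
  also have "\<dots> = (\<integral>\<^sup>+y. indicator A y \<partial>m')"
    using AE by (intro nn_integral_cong_AE) auto
  finally show "emeasure (distr (density (m \<Otimes>\<^sub>M m') g) m' snd) A = emeasure m' A" by simp
qed simp

text \<open>Two measures giving similar mass to each cell of a partition are coupled by transporting the
  common mass inside each cell and the two residual parts independently.\<close>

locale partition_pair =
  fixes m m' :: "'a measure" and I :: "'i set" and A :: "'i \<Rightarrow> 'a set"
  assumes prob: "prob_space m" "prob_space m'" and sets_eq: "sets m' = sets m"
    and fin: "finite I" and disj: "disjoint_family_on A I" and A: "\<And>i. i \<in> I \<Longrightarrow> A i \<in> sets m"
begin

definition common :: "'i \<Rightarrow> real" where
  "common i = min (measure m (A i)) (measure m' (A i))"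

text \<open>Density with respect to \<open>m\<close> of the part of the mass that stays in its cell.
  On a null cell \<open>common\<close> is 0 as well, and 0/0 is 0.\<close>

definition used :: "'a \<Rightarrow> real" where
  "used x = (\<Sum>i\<in>I. common i / measure m (A i) * indicator (A i) x)"

definition used' :: "'a \<Rightarrow> real" where
  "used' x = (\<Sum>i\<in>I. common i / measure m' (A i) * indicator (A i) x)"

definition rest :: real where
  "rest = 1 - (\<Sum>i\<in>I. common i)"

text \<open>Density, with respect to the product of \<open>m\<close> and \<open>m'\<close>, of the
  measure that spreads the common mass of each cell as a product of the two normalized
  restrictions.\<close>

definition diag_dens :: "'a \<Rightarrow> 'a \<Rightarrow> real" where
  "diag_dens x y =
     (\<Sum>i\<in>I. common i / (measure m (A i) * measure m' (A i)) * (indicator (A i) x * indicator (A i) y))"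

text \<open>Density of the product of the two residual measures divided by their common total mass.
  If nothing is left over, division by 0 makes it vanish.\<close>

definition rest_dens :: "'a \<Rightarrow> 'a \<Rightarrow> real" where
  "rest_dens x y = (1 - used x) * (1 - used' y) / rest"

lemma space_eq: "space m' = space m"
  using sets_eq by (rule sets_eq_imp_space_eq)

lemma swap: "partition_pair m' m I A"
proof (rule partition_pair.intro[OF prob(2,1) sets_eq[symmetric] fin disj])
  fix i assume "i \<in> I"
  then show "A i \<in> sets m'" unfolding sets_eq by (rule A)
qed

lemma common_nonneg: "common i \<ge> 0" and common_le: "common i \<le> measure m (A i)"
  by (auto simp: common_def)

lemma common_ratio_le_1: "common i / measure m (A i) \<le> 1"
  using common_le[of i] measure_nonneg[of m "A i"]
  by (cases "measure m (A i) = 0") (auto simp: divide_le_eq_1 less_le)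

lemma used_in: assumes "i \<in> I" "x \<in> A i" shows "used x = common i / measure m (A i)"
proof -
  have "used x = (\<Sum>j\<in>I. if j = i then common i / measure m (A i) else 0)"
    unfolding used_def using assms disj
    by (intro sum.cong) (auto simp: disjoint_family_on_def indicator_def)
  then show ?thesis using assms fin by simp
qed

lemma used_out: assumes "x \<notin> (\<Union>i\<in>I. A i)" shows "used x = 0"
  using assms by (auto simp: used_def intro!: sum.neutral)

lemma used_le_1: "used x \<le> 1"
proof (cases "x \<in> (\<Union>i\<in>I. A i)")
  case True
  then obtain i where "i \<in> I" "x \<in> A i" by blast
  then show ?thesis
    using used_in[of i x] common_ratio_le_1[of i] by simp
qed (simp add: used_out)

lemma used_measurable [measurable]: "used \<in> borel_measurable m"
  unfolding used_def using A by (intro borel_measurable_sum) simp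

lemma integral_residual: "(\<integral>\<^sup>+x. ennreal (1 - used x) \<partial>m) = ennreal rest" and rest_nonneg: "rest \<ge> 0"
proof -
  interpret prob_space m by (rule prob)
  have int: "integrable m (\<lambda>x. common i / measure m (A i) * indicator (A i) x)" if "i \<in> I" for i
    using A[OF that] by (intro integrable_mult_right integrable_real_indicator) (auto simp: emeasure_eq_measure)
  then have int_u: "integrable m used" unfolding used_def by (intro Bochner_Integration.integrable_sum)
  have "(\<integral>x. used x \<partial>m) = (\<Sum>i\<in>I. common i / measure m (A i) * measure m (A i))"
    unfolding used_def using int A sets.sets_into_space[OF A]
    by (subst Bochner_Integration.integral_sum) (auto intro!: sum.cong simp: Int_absorb2)
  also have "\<dots> = (\<Sum>i\<in>I. common i)"
    \<comment> \<open>On a null cell \<open>common i\<close> is squeezed to 0, so the cancellation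
      is valid there too.\<close>
    using common_le common_nonneg by (intro sum.cong) (auto, metis order_antisym)
  finally have *: "(\<integral>x. 1 - used x \<partial>m) = rest" using int_u prob_space by (simp add: rest_def)
  show "(\<integral>\<^sup>+x. ennreal (1 - used x) \<partial>m) = ennreal rest"
    using int_u used_le_1 by (subst nn_integral_eq_integral) (auto simp: *)
  show "rest \<ge> 0" unfolding *[symmetric] using used_le_1 by (intro integral_nonneg_AE) auto
qed

text \<open>Exchanging the measures transposes the densities, so each fact about first marginals
  also yields the one about second marginals.\<close>

lemma swap_simps:
  "partition_pair.common m' m A = common" "partition_pair.used m' m I A = used'"
  "partition_pair.used' m' m I A = used" "partition_pair.rest m' m I A = rest"
  "partition_pair.diag_dens m' m I A y x = diag_dens x y"
  "partition_pair.rest_dens m' m I A y x = rest_dens x y"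
proof -
  interpret S: partition_pair m' m I A by (rule swap)
  show c: "S.common = common" by (auto simp: S.common_def common_def min.commute)
  show u: "S.used = used'" by (auto simp: S.used_def used'_def c)
  show u': "S.used' = used" by (auto simp: S.used'_def used_def c)
  show r: "S.rest = rest" by (auto simp: S.rest_def rest_def c)
  show "S.diag_dens y x = diag_dens x y" by (simp add: S.diag_dens_def diag_dens_def c mult.commute)
  show "S.rest_dens y x = rest_dens x y" by (simp add: S.rest_dens_def rest_dens_def u u' r mult.commute)
qed

lemma used'_le_1: "used' x \<le> 1" and used'_measurable [measurable]: "used' \<in> borel_measurable m'"
  and integral_residual': "(\<integral>\<^sup>+x. ennreal (1 - used' x) \<partial>m') = ennreal rest"
  using partition_pair.used_le_1[OF swap] partition_pair.used_measurable[OF swap]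
    partition_pair.integral_residual[OF swap] by (simp_all add: swap_simps)

lemma dens_nonneg: "diag_dens x y \<ge> 0" "rest_dens x y \<ge> 0"
  using common_nonneg used_le_1 used'_le_1 rest_nonneg
  by (auto simp: diag_dens_def rest_dens_def intro!: sum_nonneg)

lemma dens_measurable [measurable]:
  "(\<lambda>z. diag_dens (fst z) (snd z)) \<in> borel_measurable (m \<Otimes>\<^sub>M m')"
  "(\<lambda>z. rest_dens (fst z) (snd z)) \<in> borel_measurable (m \<Otimes>\<^sub>M m')"
proof -
  have [measurable]: "A i \<in> sets m" "A i \<in> sets m'" if "i \<in> I" for i
    using A[OF that] sets_eq by auto
  show "(\<lambda>z. diag_dens (fst z) (snd z)) \<in> borel_measurable (m \<Otimes>\<^sub>M m')"
    unfolding diag_dens_def by (intro borel_measurable_sum) measurable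
  show "(\<lambda>z. rest_dens (fst z) (snd z)) \<in> borel_measurable (m \<Otimes>\<^sub>M m')"
    unfolding rest_dens_def by measurable
qed

lemma integral_diag_dens:
  "(\<integral>\<^sup>+y. ennreal (diag_dens x y) \<partial>m') = ennreal (used x)"
proof -
  interpret m': prob_space m' by (rule prob)
  let ?q = "\<lambda>i. common i / (measure m (A i) * measure m' (A i)) * indicator (A i) x"
  have q: "?q i \<ge> 0" for i using common_nonneg by simp
  have A': "A i \<in> sets m'" if "i \<in> I" for i using A[OF that] sets_eq by simp
  have "(\<integral>\<^sup>+y. ennreal (diag_dens x y) \<partial>m') = (\<integral>\<^sup>+y. (\<Sum>i\<in>I. ennreal (?q i) * indicator (A i) y) \<partial>m')"
  proof (intro nn_integral_cong)
    fix y
    have "diag_dens x y = (\<Sum>i\<in>I. ?q i * indicator (A i) y)"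
      unfolding diag_dens_def by (simp add: mult.assoc)
    then have "ennreal (diag_dens x y) = ennreal (\<Sum>i\<in>I. ?q i * indicator (A i) y)" by simp
    also have "\<dots> = (\<Sum>i\<in>I. ennreal (?q i * indicator (A i) y))"
      by (intro sum_ennreal[symmetric] mult_nonneg_nonneg[OF q]) simp
    also have "\<dots> = (\<Sum>i\<in>I. ennreal (?q i) * indicator (A i) y)"
      by (intro sum.cong) (auto simp: indicator_def)
    finally show "ennreal (diag_dens x y) = (\<Sum>i\<in>I. ennreal (?q i) * indicator (A i) y)" .
  qed
  also have "\<dots> = (\<Sum>i\<in>I. ennreal (?q i) * emeasure m' (A i))"
    using A' by (subst nn_integral_sum) (auto simp: nn_integral_cmult_indicator)
  also have "\<dots> = (\<Sum>i\<in>I. ennreal (?q i * measure m' (A i)))"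
    unfolding m'.emeasure_eq_measure by (intro sum.cong refl ennreal_mult[symmetric] q measure_nonneg)
  also have "\<dots> = ennreal (\<Sum>i\<in>I. ?q i * measure m' (A i))"
    by (intro sum_ennreal mult_nonneg_nonneg q measure_nonneg)
  also have "(\<Sum>i\<in>I. ?q i * measure m' (A i)) = used x"
    unfolding used_def
  proof (intro sum.cong refl)
    fix i assume "i \<in> I"
    show "?q i * measure m' (A i) = common i / measure m (A i) * indicator (A i) x"
      \<comment> \<open>If \<open>m'\<close> does not charge the cell, \<open>common i\<close> is 0
        and both sides vanish.\<close>
      by (cases "measure m' (A i) = 0") (auto simp: common_def)
  qed
  finally show ?thesis .
qed

lemma integral_rest_dens:
  "(\<integral>\<^sup>+y. ennreal (rest_dens x y) \<partial>m') = (if rest = 0 then 0 else ennreal (1 - used x))"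
proof -
  have [measurable]: "used' \<in> borel_measurable m'" by (rule used'_measurable)
  have "(\<integral>\<^sup>+y. ennreal (rest_dens x y) \<partial>m') = (\<integral>\<^sup>+y. ennreal ((1 - used x) / rest) * ennreal (1 - used' y) \<partial>m')"
    using used_le_1 used'_le_1 rest_nonneg
    by (intro nn_integral_cong) (auto simp: rest_dens_def ennreal_mult[symmetric])
  also have "\<dots> = ennreal ((1 - used x) / rest) * ennreal rest"
    by (subst nn_integral_cmult) (auto simp: integral_residual')
  also have "\<dots> = (if rest = 0 then 0 else ennreal (1 - used x))"
    using used_le_1 rest_nonneg by (auto simp: ennreal_mult[symmetric])
  finally show ?thesis .
qed

text \<open>Only almost everywhere: when \<open>rest\<close> is 0 the residual density vanishes, and
  \<open>used\<close> equals 1 merely off a null set, because \<open>1 - used\<close> has integral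
  0.\<close>

lemma marginal: "AE x in m. (\<integral>\<^sup>+y. ennreal (diag_dens x y + rest_dens x y) \<partial>m') = 1"
proof -
  have AE_used: "AE x in m. rest = 0 \<longrightarrow> used x = 1"
  proof (cases "rest = 0")
    case True
    then have "AE x in m. ennreal (1 - used x) = 0"
      using integral_residual by (subst nn_integral_0_iff_AE[symmetric]) auto
    then show ?thesis using used_le_1 by (auto simp: ennreal_eq_0_iff intro: antisym)
  qed simp
  have *: "(\<integral>\<^sup>+y. ennreal (diag_dens x y + rest_dens x y) \<partial>m') = 1"
    if "rest = 0 \<longrightarrow> used x = 1" "x \<in> space m" for x
  proof -
    have [measurable]: "diag_dens x \<in> borel_measurable m'" "rest_dens x \<in> borel_measurable m'"
      using measurable_compose_Pair1[OF that(2) dens_measurable(1)]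
        measurable_compose_Pair1[OF that(2) dens_measurable(2)] by simp_all
    have "(\<integral>\<^sup>+y. ennreal (diag_dens x y + rest_dens x y) \<partial>m')
        = (\<integral>\<^sup>+y. ennreal (diag_dens x y) \<partial>m') + (\<integral>\<^sup>+y. ennreal (rest_dens x y) \<partial>m')"
      using dens_nonneg by (subst nn_integral_add[symmetric]) (auto simp: ennreal_plus)
    also have "\<dots> = 1"
    proof -
      have "used x \<ge> 0" using common_nonneg by (auto simp: used_def intro!: sum_nonneg)
      then show ?thesis using that(1) used_le_1[of x]
        unfolding integral_diag_dens integral_rest_dens by (auto simp: ennreal_plus[symmetric] simp del: ennreal_plus)
    qed
    finally show ?thesis .
  qed
  from AE_used AE_space show ?thesis by eventually_elim (rule *)
qed

text \<open>In a cell the residual mass is the surplus of \<open>m\<close> over the common part,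
  hence at most the difference of the two cell masses. Off the cells \<open>used\<close> is 0 and
  all mass is residual.\<close>

lemma residual_cost:
  fixes \<phi> :: "'a \<Rightarrow> ennreal"
  assumes [measurable]: "\<phi> \<in> borel_measurable m" and R: "\<And>i x. i \<in> I \<Longrightarrow> x \<in> A i \<Longrightarrow> \<phi> x \<le> R"
  shows "(\<integral>\<^sup>+x. ennreal (1 - used x) * \<phi> x \<partial>m)
    \<le> R * ennreal (\<Sum>i\<in>I. \<bar>measure m (A i) - measure m' (A i)\<bar>)
      + (\<integral>\<^sup>+x. \<phi> x * indicator (space m - (\<Union>i\<in>I. A i)) x \<partial>m)"
proof -
  interpret m: prob_space m by (rule prob)
  let ?a = "\<lambda>i. 1 - common i / measure m (A i)"
  have a: "?a i \<ge> 0" for i using common_ratio_le_1[of i] by simp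
  have [measurable]: "A i \<in> sets m" if "i \<in> I" for i using A[OF that] .
  have UA[measurable]: "(\<Union>i\<in>I. A i) \<in> sets m" using fin A by auto
  have "(\<integral>\<^sup>+x. ennreal (1 - used x) * \<phi> x \<partial>m) \<le>
    (\<integral>\<^sup>+x. (\<Sum>i\<in>I. R * ennreal (?a i) * indicator (A i) x) + \<phi> x * indicator (space m - (\<Union>i\<in>I. A i)) x \<partial>m)"
  proof (intro nn_integral_mono)
    fix x assume x: "x \<in> space m"
    show "ennreal (1 - used x) * \<phi> x \<le>
      (\<Sum>i\<in>I. R * ennreal (?a i) * indicator (A i) x) + \<phi> x * indicator (space m - (\<Union>i\<in>I. A i)) x"
    proof (cases "x \<in> (\<Union>i\<in>I. A i)")
      case True
      then obtain i where i: "i \<in> I" "x \<in> A i" by blast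
      have "ennreal (1 - used x) * \<phi> x = \<phi> x * ennreal (?a i)"
        by (simp add: used_in[OF i] mult.commute)
      also have "\<dots> \<le> R * ennreal (?a i)" by (intro mult_right_mono R[OF i]) simp
      also have "\<dots> = R * ennreal (?a i) * indicator (A i) x" using i by simp
      also have "\<dots> \<le> (\<Sum>i\<in>I. R * ennreal (?a i) * indicator (A i) x)"
        using i fin by (intro member_le_sum) auto
      finally show ?thesis using True by simp
    next
      case False
      then show ?thesis using x used_out[OF False] by (simp add: indicator_def)
    qed
  qed
  also have "\<dots> = (\<Sum>i\<in>I. R * ennreal (?a i) * emeasure m (A i))
      + (\<integral>\<^sup>+x. \<phi> x * indicator (space m - (\<Union>i\<in>I. A i)) x \<partial>m)"
  proof (subst nn_integral_add)
    show "(\<lambda>x. \<Sum>i\<in>I. R * ennreal (?a i) * indicator (A i) x) \<in> borel_measurable m"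
      by (intro borel_measurable_sum) measurable
    show "(\<lambda>x. \<phi> x * indicator (space m - (\<Union>i\<in>I. A i)) x) \<in> borel_measurable m"
      by measurable
    show "(\<integral>\<^sup>+x. (\<Sum>i\<in>I. R * ennreal (?a i) * indicator (A i) x) \<partial>m)
        + (\<integral>\<^sup>+x. \<phi> x * indicator (space m - (\<Union>i\<in>I. A i)) x \<partial>m)
      = (\<Sum>i\<in>I. R * ennreal (?a i) * emeasure m (A i))
        + (\<integral>\<^sup>+x. \<phi> x * indicator (space m - (\<Union>i\<in>I. A i)) x \<partial>m)"
      using A by (subst nn_integral_sum) (auto simp: nn_integral_cmult_indicator)
  qed
  also have "(\<Sum>i\<in>I. R * ennreal (?a i) * emeasure m (A i))
      \<le> (\<Sum>i\<in>I. R * ennreal \<bar>measure m (A i) - measure m' (A i)\<bar>)"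
  proof (intro sum_mono)
    fix i assume "i \<in> I"
    have "?a i * measure m (A i) \<le> \<bar>measure m (A i) - measure m' (A i)\<bar>"
      by (cases "measure m (A i) = 0") (auto simp: common_def left_diff_distrib)
    then have "ennreal (?a i) * emeasure m (A i) \<le> ennreal \<bar>measure m (A i) - measure m' (A i)\<bar>"
      using a by (simp add: m.emeasure_eq_measure ennreal_mult[symmetric] ennreal_leI)
    then show "R * ennreal (?a i) * emeasure m (A i) \<le> R * ennreal \<bar>measure m (A i) - measure m' (A i)\<bar>"
      unfolding mult.assoc by (intro mult_left_mono) auto
  qed
  also have "\<dots> = R * ennreal (\<Sum>i\<in>I. \<bar>measure m (A i) - measure m' (A i)\<bar>)"
    by (simp add: sum_distrib_left[symmetric] sum_ennreal)
  finally show ?thesis by (simp add: add_right_mono)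
qed

text \<open>For nonzero \<open>rest\<close> the inner integral of the density is exactly
  \<open>1 - used x\<close>; the inequality absorbs the case \<open>rest = 0\<close>, where it is
  0.\<close>

lemma rest_dens_cost:
  fixes \<phi> :: "'a \<Rightarrow> ennreal"
  assumes [measurable]: "\<phi> \<in> borel_measurable m"
  shows "(\<integral>\<^sup>+x. \<integral>\<^sup>+y. ennreal (rest_dens x y) * \<phi> x \<partial>m' \<partial>m) \<le> (\<integral>\<^sup>+x. ennreal (1 - used x) * \<phi> x \<partial>m)"
proof (intro nn_integral_mono)
  fix x assume x: "x \<in> space m"
  have [measurable]: "rest_dens x \<in> borel_measurable m'"
    using measurable_compose_Pair1[OF x dens_measurable(2)] by simp
  have "(\<integral>\<^sup>+y. ennreal (rest_dens x y) * \<phi> x \<partial>m') = (\<integral>\<^sup>+y. ennreal (rest_dens x y) \<partial>m') * \<phi> x"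
    by (intro nn_integral_multc) measurable
  also have "\<dots> \<le> ennreal (1 - used x) * \<phi> x"
    unfolding integral_rest_dens by (intro mult_right_mono) auto
  finally show "(\<integral>\<^sup>+y. ennreal (rest_dens x y) * \<phi> x \<partial>m') \<le> ennreal (1 - used x) * \<phi> x" .
qed

text \<open>The diagonal part charges only pairs lying in one cell, where the cost is at most
  \<open>e\<close>. For the residual part the bound by \<phi> x + \<phi> y separates the variables,
  so each summand is integrated against a single residual measure.\<close>

lemma partition_coupling:
  fixes c :: "'a \<times> 'a \<Rightarrow> ennreal" and \<phi> :: "'a \<Rightarrow> ennreal" and e R :: ennreal
  assumes c[measurable]: "c \<in> borel_measurable (m \<Otimes>\<^sub>M m')" and \<phi>[measurable]: "\<phi> \<in> borel_measurable m"
    and cell: "\<And>i x y. i \<in> I \<Longrightarrow> x \<in> A i \<Longrightarrow> y \<in> A i \<Longrightarrow> c (x, y) \<le> e"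
    and c_le: "\<And>x y. x \<in> space m \<Longrightarrow> y \<in> space m \<Longrightarrow> c (x, y) \<le> \<phi> x + \<phi> y"
    and R: "\<And>i x. i \<in> I \<Longrightarrow> x \<in> A i \<Longrightarrow> \<phi> x \<le> R"
  shows "\<exists>\<pi>. prob_space \<pi> \<and> sets \<pi> = sets (m \<Otimes>\<^sub>M m') \<and> distr \<pi> m fst = m \<and> distr \<pi> m' snd = m' \<and>
    (\<integral>\<^sup>+z. c z \<partial>\<pi>) \<le> e
      + (R * ennreal (\<Sum>i\<in>I. \<bar>measure m (A i) - measure m' (A i)\<bar>)
        + (\<integral>\<^sup>+x. \<phi> x * indicator (space m - (\<Union>i\<in>I. A i)) x \<partial>m))
      + (R * ennreal (\<Sum>i\<in>I. \<bar>measure m (A i) - measure m' (A i)\<bar>)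
        + (\<integral>\<^sup>+x. \<phi> x * indicator (space m - (\<Union>i\<in>I. A i)) x \<partial>m'))"
proof -
  interpret m: prob_space m by (rule prob)
  interpret m': prob_space m' by (rule prob)
  interpret pair_sigma_finite m m' ..
  interpret S: partition_pair m' m I A by (rule swap)
  let ?g = "\<lambda>z. ennreal (diag_dens (fst z) (snd z) + rest_dens (fst z) (snd z))"
  let ?g1 = "\<lambda>z. ennreal (diag_dens (fst z) (snd z))" and ?g2 = "\<lambda>z. ennreal (rest_dens (fst z) (snd z))"
  let ?P = "m \<Otimes>\<^sub>M m'"
  define \<pi> where "\<pi> = density ?P ?g"
  have g[measurable]: "?g \<in> borel_measurable ?P" by measurable
  have [measurable]: "\<phi> \<in> borel_measurable m'" using \<phi> sets_eq by (simp cong: measurable_cong_sets)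
  have marg: "distr \<pi> m fst = m" "distr \<pi> m' snd = m'"
    unfolding \<pi>_def using marginal S.marginal
    by (intro distr_density_fst distr_density_snd prob g; simp add: swap_simps)+
  have "prob_space \<pi>"
  proof
    have "emeasure \<pi> (space \<pi>) = emeasure (distr \<pi> m fst) (space m)"
      by (subst emeasure_distr) (auto simp: \<pi>_def space_pair_measure intro!: arg_cong2[where f=emeasure])
    then show "emeasure \<pi> (space \<pi>) = 1" by (simp add: marg m.emeasure_space_1)
  qed
  moreover have "sets \<pi> = sets ?P" by (simp add: \<pi>_def)
  moreover have cost: "(\<integral>\<^sup>+z. c z \<partial>\<pi>) \<le> e
      + (\<integral>\<^sup>+x. ennreal (1 - used x) * \<phi> x \<partial>m) + (\<integral>\<^sup>+y. ennreal (1 - used' y) * \<phi> y \<partial>m')"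
  proof -
    have "(\<integral>\<^sup>+z. c z \<partial>\<pi>) = (\<integral>\<^sup>+z. ?g z * c z \<partial>?P)"
      unfolding \<pi>_def by (rule nn_integral_density) measurable
    also have "\<dots> \<le> (\<integral>\<^sup>+z. ?g1 z * e + (?g2 z * \<phi> (fst z) + ?g2 z * \<phi> (snd z)) \<partial>?P)"
    proof (intro nn_integral_mono)
      fix z assume "z \<in> space ?P"
      then have z: "fst z \<in> space m" "snd z \<in> space m"
        unfolding space_pair_measure space_eq by (rule mem_Times_iff[THEN iffD1, THEN conjunct1],
            rule mem_Times_iff[THEN iffD1, THEN conjunct2])
      have 1: "?g1 z * c z \<le> ?g1 z * e"
      proof (cases "diag_dens (fst z) (snd z) = 0")
        case False
        then obtain i where "i \<in> I" "fst z \<in> A i" "snd z \<in> A i"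
          unfolding diag_dens_def by (metis (no_types, lifting) indicator_simps(2) mult_zero_left mult_zero_right sum.neutral)
        then have "c z \<le> e" using cell[of i "fst z" "snd z"] by simp
        then show ?thesis by (intro mult_left_mono) auto
      qed simp
      have "?g2 z * c z \<le> ?g2 z * (\<phi> (fst z) + \<phi> (snd z))"
        using c_le[OF z] by (intro mult_left_mono) auto
      then show "?g z * c z \<le> ?g1 z * e + (?g2 z * \<phi> (fst z) + ?g2 z * \<phi> (snd z))"
        using 1 dens_nonneg by (simp add: ennreal_plus distrib_right distrib_left add_mono)
    qed
    also have "\<dots> = (\<integral>\<^sup>+z. ?g1 z * e \<partial>?P) + ((\<integral>\<^sup>+z. ?g2 z * \<phi> (fst z) \<partial>?P) + (\<integral>\<^sup>+z. ?g2 z * \<phi> (snd z) \<partial>?P))"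
    proof -
      have h: "(\<lambda>z. ?g1 z * e) \<in> borel_measurable ?P" "(\<lambda>z. ?g2 z * \<phi> (fst z)) \<in> borel_measurable ?P"
        "(\<lambda>z. ?g2 z * \<phi> (snd z)) \<in> borel_measurable ?P" by measurable
      show ?thesis
        unfolding nn_integral_add[OF h(1) borel_measurable_add[OF h(2,3)]] nn_integral_add[OF h(2,3)] ..
    qed
    \<comment> \<open>Enlarging the diagonal density to the full one leaves a total mass of 1 in
      front of \<open>e\<close>.\<close>
    also have "(\<integral>\<^sup>+z. ?g1 z * e \<partial>?P) \<le> (\<integral>\<^sup>+z. ?g z * e \<partial>?P)"
      using dens_nonneg by (intro nn_integral_mono mult_right_mono ennreal_leI) auto
    also have "\<dots> = (\<integral>\<^sup>+z. ?g z \<partial>?P) * e" by (rule nn_integral_multc) measurable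
    also have "(\<integral>\<^sup>+z. ?g z \<partial>?P) = 1"
    proof -
      have "(\<integral>\<^sup>+z. ?g z \<partial>?P) = (\<integral>\<^sup>+x. \<integral>\<^sup>+y. ?g (x, y) \<partial>m' \<partial>m)"
        by (subst m'.nn_integral_fst) auto
      also have "\<dots> = (\<integral>\<^sup>+x. 1 \<partial>m)"
        using marginal by (intro nn_integral_cong_AE) simp
      finally show ?thesis by (simp add: m.emeasure_space_1)
    qed
    also have "(\<integral>\<^sup>+z. ?g2 z * \<phi> (fst z) \<partial>?P) = (\<integral>\<^sup>+x. \<integral>\<^sup>+y. ennreal (rest_dens x y) * \<phi> x \<partial>m' \<partial>m)"
      by (subst m'.nn_integral_fst[symmetric]) auto
    also have "\<dots> \<le> (\<integral>\<^sup>+x. ennreal (1 - used x) * \<phi> x \<partial>m)" by (rule rest_dens_cost) measurable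
    also have "(\<integral>\<^sup>+z. ?g2 z * \<phi> (snd z) \<partial>?P) = (\<integral>\<^sup>+y. \<integral>\<^sup>+x. ennreal (rest_dens x y) * \<phi> y \<partial>m \<partial>m')"
      by (subst nn_integral_snd[symmetric]) auto
    also have "\<dots> \<le> (\<integral>\<^sup>+y. ennreal (1 - used' y) * \<phi> y \<partial>m')"
      using S.rest_dens_cost[of \<phi>] by (simp add: swap_simps)
    finally show ?thesis by (simp add: add.assoc add_mono)
  qed
  moreover have res: "(\<integral>\<^sup>+x. ennreal (1 - used x) * \<phi> x \<partial>m)
    \<le> R * ennreal (\<Sum>i\<in>I. \<bar>measure m (A i) - measure m' (A i)\<bar>)
      + (\<integral>\<^sup>+x. \<phi> x * indicator (space m - (\<Union>i\<in>I. A i)) x \<partial>m)"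
    using R by (intro residual_cost) auto
  moreover have res': "(\<integral>\<^sup>+x. ennreal (1 - used' x) * \<phi> x \<partial>m')
    \<le> R * ennreal (\<Sum>i\<in>I. \<bar>measure m (A i) - measure m' (A i)\<bar>)
      + (\<integral>\<^sup>+x. \<phi> x * indicator (space m - (\<Union>i\<in>I. A i)) x \<partial>m')"
    using S.residual_cost[of \<phi> R] R by (simp add: swap_simps space_eq abs_minus_commute)
  ultimately show ?thesis
    by (intro exI[of _ \<pi>] conjI marg order_trans[OF cost] add_mono order_refl)
qed

end

section \<open>Layer-cake formula and a power inequality\<close>

text \<open>Reduces integrals to masses of superlevel sets, the form in which the stochastic order
  can be applied. Where \<open>f\<close> is negative, \<open>ennreal\<close> contributes 0 and so do
  the levels from 0 on.\<close>

lemma nn_integral_layer_cake: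
  fixes f :: "'a \<Rightarrow> real"
  assumes "sigma_finite_measure m" and [measurable]: "f \<in> borel_measurable m"
  shows "(\<integral>\<^sup>+x. ennreal (f x) \<partial>m) = (\<integral>\<^sup>+t. emeasure m {x\<in>space m. f x > t} * indicator {0..} t \<partial>lborel)"
proof -
  interpret sigma_finite_measure m by fact
  interpret pair_sigma_finite m lborel ..
  let ?h = "\<lambda>x t. if 0 \<le> t \<and> t < f x then 1 else (0::ennreal)"
  have "(\<integral>\<^sup>+x. ennreal (f x) \<partial>m) = (\<integral>\<^sup>+x. \<integral>\<^sup>+t. ?h x t \<partial>lborel \<partial>m)"
  proof (intro nn_integral_cong)
    fix x
    have "(\<integral>\<^sup>+t. ?h x t \<partial>lborel) = (\<integral>\<^sup>+t. indicator {0..<f x} t \<partial>lborel)"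
      by (intro nn_integral_cong) (auto simp: indicator_def)
    also have "\<dots> = ennreal (f x)"
      by (cases "0 \<le> f x") (auto simp: ennreal_neg)
    finally show "ennreal (f x) = (\<integral>\<^sup>+t. ?h x t \<partial>lborel)" by simp
  qed
  also have "\<dots> = (\<integral>\<^sup>+t. \<integral>\<^sup>+x. ?h x t \<partial>m \<partial>lborel)"
    by (rule Fubini'[symmetric]) measurable
  also have "\<dots> = (\<integral>\<^sup>+t. emeasure m {x\<in>space m. f x > t} * indicator {0..} t \<partial>lborel)"
  proof (intro nn_integral_cong)
    fix t
    have "(\<integral>\<^sup>+x. ?h x t \<partial>m) = (\<integral>\<^sup>+x. indicator {0..} t * indicator {x\<in>space m. f x > t} x \<partial>m)"
      by (intro nn_integral_cong) (auto simp: indicator_def)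
    also have "\<dots> = indicator {0..} t * emeasure m {x\<in>space m. f x > t}"
      by (subst nn_integral_cmult_indicator) auto
    finally show "(\<integral>\<^sup>+x. ?h x t \<partial>m) = emeasure m {x\<in>space m. f x > t} * indicator {0..} t"
      by (simp add: mult.commute)
  qed
  finally show ?thesis .
qed

text \<open>The constant comes from bounding the sum by twice the maximum.\<close>

lemma powr_add_le:
  fixes a b p :: real
  assumes "a \<ge> 0" "b \<ge> 0" "p \<ge> 0"
  shows "(a + b) powr p \<le> 2 powr p * a powr p + 2 powr p * b powr p"
proof -
  have "(a + b) powr p \<le> (2 * max a b) powr p" using assms by (intro powr_mono2) auto
  also have "\<dots> = 2 powr p * max a b powr p" using assms by (simp add: powr_mult)
  also have "\<dots> \<le> 2 powr p * (a powr p + b powr p)"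
    by (intro mult_left_mono) (auto simp: max_def)
  finally show ?thesis by (simp add: distrib_left)
qed

section \<open>The Thompson metric\<close>

locale thompson_cone =
  fixes C :: "'a::finite_dimensional_banach set"
  assumes open_cone: "open_cone C" and proper: "proper_cone (closure C)"
begin

abbreviation "K \<equiv> closure C"
abbreviation "D \<equiv> thompson_dist C"
abbreviation "N \<equiv> restrict_space borel C"

lemma C_open: "open C" and C_nonempty: "C \<noteq> {}"
  and C_scale: "x \<in> C \<Longrightarrow> t > 0 \<Longrightarrow> t *\<^sub>R x \<in> C"
  using open_cone by (auto simp: open_cone_def)

lemma C_add: assumes "x \<in> C" "y \<in> C" shows "x + y \<in> C"
proof -
  have "(1/2) *\<^sub>R x + (1/2) *\<^sub>R y \<in> C"
    using open_cone assms by (auto simp: open_cone_def intro!: convexD)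
  then have "2 *\<^sub>R ((1/2) *\<^sub>R x + (1/2) *\<^sub>R y) \<in> C" by (rule C_scale) simp
  then show ?thesis by (simp add: scaleR_add_right)
qed

lemma C_imp_K: "x \<in> C \<Longrightarrow> x \<in> K"
  using closure_subset by blast

lemma K_add: assumes "x \<in> K" "y \<in> K" shows "x + y \<in> K"
proof -
  obtain f g where "\<forall>n. f n \<in> C" "f \<longlonglongrightarrow> x" "\<forall>n. g n \<in> C" "g \<longlonglongrightarrow> y"
    using assms by (auto simp: closure_sequential)
  then show ?thesis
    unfolding closure_sequential by (intro exI[of _ "\<lambda>n. f n + g n"]) (auto intro: C_add tendsto_add)
qed

lemma K_zero: "0 \<in> K"
proof -
  obtain x where "x \<in> C" using C_nonempty by blast
  then have "\<And>n. (1 / real (Suc n)) *\<^sub>R x \<in> C" by (intro C_scale) auto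
  moreover have "(\<lambda>n. (1 / real (Suc n)) *\<^sub>R x) \<longlonglongrightarrow> 0 *\<^sub>R x"
    by (intro tendsto_scaleR LIMSEQ_Suc[OF lim_const_over_n] tendsto_const)
  ultimately show ?thesis
    unfolding closure_sequential by (intro exI[of _ "\<lambda>n. (1 / real (Suc n)) *\<^sub>R x"]) simp
qed

lemma K_scale: assumes "x \<in> K" "t \<ge> 0" shows "t *\<^sub>R x \<in> K"
proof (cases "t = 0")
  case False
  obtain f where "\<forall>n. f n \<in> C" "f \<longlonglongrightarrow> x" using assms by (auto simp: closure_sequential)
  then show ?thesis
    unfolding closure_sequential using False assms(2)
    by (intro exI[of _ "\<lambda>n. t *\<^sub>R f n"]) (auto intro!: C_scale tendsto_intros)
qed (simp add: K_zero)

lemma K_scale_iff: assumes "t > 0" shows "t *\<^sub>R x \<in> K \<longleftrightarrow> x \<in> K"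
proof
  assume "t *\<^sub>R x \<in> K"
  then have "(1 / t) *\<^sub>R (t *\<^sub>R x) \<in> K" using assms by (intro K_scale[of "t *\<^sub>R x"]) auto
  then show "x \<in> K" using assms by simp
qed (use assms K_scale in auto)

text \<open>Replace \<open>x\<close> by a nearby point of \<open>C\<close> and move the small error
  to \<open>y\<close>, which has room around it because \<open>C\<close> is open.\<close>

lemma K_add_C: assumes "x \<in> K" "y \<in> C" shows "x + y \<in> C"
proof -
  obtain e where e: "e > 0" "ball y e \<subseteq> C" using C_open assms(2) open_contains_ball by blast
  obtain x' where x': "x' \<in> C" "dist x' x < e"
    using assms(1) e(1) unfolding closure_approachable by blast
  then have "y + (x - x') \<in> C"
    using e(2) by (intro subsetD[OF e(2)]) (simp add: dist_norm norm_minus_commute)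
  then have "x' + (y + (x - x')) \<in> C" by (rule C_add[OF x'(1)])
  moreover have "x' + (y + (x - x')) = x + y" by simp
  ultimately show ?thesis by metis
qed

lemma K_pointed: "x \<in> K \<Longrightarrow> - x \<in> K \<Longrightarrow> x = 0"
  using proper unfolding proper_cone_def by (metis IntI add.inverse_inverse image_eqI singletonD)

text \<open>Normality of the cone. Its unit vectors form a compact set, so adding the closed cone
  gives a closed set, which misses 0 by pointedness. A ball of radius \<delta> around 0 avoids it,
  and scaling gives the inequality.\<close>

lemma K_normal: "\<exists>\<delta>>0. \<forall>x\<in>K. \<forall>y\<in>K. norm x * \<delta> \<le> norm (x + y)"
proof -
  define Z where "Z = K \<inter> sphere 0 1"
  have "Z = K \<inter> norm -` {1}" by (auto simp: Z_def)
  then have "closed Z" by (auto intro!: closed_Int closed_vimage continuous_intros)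
  moreover have "bounded Z" by (auto simp: Z_def bounded_iff)
  ultimately have "compact Z" by (simp add: compact_eq_bounded_closed)
  then have cl: "closed (\<Union>x\<in>Z. \<Union>y\<in>K. {x + y})"
    by (intro compact_closed_sums closed_closure)
  have "0 \<notin> (\<Union>x\<in>Z. \<Union>y\<in>K. {x + y})"
  proof
    assume "0 \<in> (\<Union>x\<in>Z. \<Union>y\<in>K. {x + y})"
    then obtain x y where xy: "x \<in> Z" "y \<in> K" "0 = x + y" by blast
    then have "y = - x" by (metis neg_eq_iff_add_eq_0)
    then have "x = 0" using xy(1,2) by (intro K_pointed) (auto simp: Z_def)
    then show False using xy(1) by (simp add: Z_def)
  qed
  then have "0 \<in> - (\<Union>x\<in>Z. \<Union>y\<in>K. {x + y})" by (rule Compl_iff[THEN iffD2])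
  moreover have "open (- (\<Union>x\<in>Z. \<Union>y\<in>K. {x + y}))" using cl by (rule open_Compl)
  ultimately obtain \<delta> where d: "\<delta> > 0" "ball 0 \<delta> \<subseteq> - (\<Union>x\<in>Z. \<Union>y\<in>K. {x + y})"
    by (meson open_contains_ball)
  show ?thesis
  proof (intro exI[of _ \<delta>] conjI ballI d)
    fix x y assume xy: "x \<in> K" "y \<in> K"
    show "norm x * \<delta> \<le> norm (x + y)"
    proof (cases "x = 0")
      case False
      let ?t = "1 / norm x"
      have "?t *\<^sub>R x \<in> Z" "?t *\<^sub>R y \<in> K"
        using False xy by (auto simp: Z_def intro!: K_scale)
      then have "?t *\<^sub>R x + ?t *\<^sub>R y \<notin> ball 0 \<delta>" using d(2) by blast
      then have "\<delta> \<le> norm (?t *\<^sub>R (x + y))"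
        unfolding scaleR_add_right[symmetric] by simp
      also have "\<dots> = 1 / norm x * norm (x + y)"
        by (simp only: norm_scaleR abs_divide abs_one abs_norm_cancel)
      finally show ?thesis using False by (simp add: field_simps)
    qed simp
  qed
qed

text \<open>If the open cone contains 0, a ball around 0 scales up to the whole space, and
  pointedness then leaves only the zero space.\<close>

lemma thompson_degenerate:
  assumes "0 \<in> C" shows "(x::'a) = 0"
proof -
  have *: "y \<in> C" for y
  proof -
    obtain e where e: "e > 0" "ball 0 e \<subseteq> C" using C_open assms open_contains_ball by blast
    define q where "q = norm y + 1"
    have q: "q > 0" using norm_ge_zero[of y] by (simp add: q_def add_nonneg_pos)
    have "norm ((e / (2 * q)) *\<^sub>R y) = e / (2 * q) * norm y"
      using e(1) q by simp
    also have "\<dots> \<le> e / (2 * q) * q"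
      using e(1) q by (intro mult_left_mono) (auto simp: q_def)
    also have "\<dots> = e / 2" using q by simp
    finally have "(e / (2 * q)) *\<^sub>R y \<in> C" using e by auto
    then have "(2 * q / e) *\<^sub>R ((e / (2 * q)) *\<^sub>R y) \<in> C"
      by (rule C_scale) (use e q in auto)
    then show ?thesis using e(1) q by simp
  qed
  show ?thesis using *[of x] *[of "- x"] by (intro K_pointed C_imp_K)
qed

text \<open>The infimum is attained, because the admissible factors together with a possible 0 lie
  in a closed set. The value 0 would put \<open>- x\<close> into the closure, against
  pointedness.\<close>

lemma thompson_M_props:
  assumes "x \<in> C" "y \<in> C" "0 \<notin> C"
  shows "thompson_M C x y > 0" and "l > 0 \<Longrightarrow> cone_le C x (l *\<^sub>R y) \<longleftrightarrow> thompson_M C x y \<le> l"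
proof -
  let ?S = "{l. l > 0 \<and> cone_le C x (l *\<^sub>R y)}" and ?T = "{l. l \<ge> 0 \<and> l *\<^sub>R y - x \<in> K}"
  let ?M = "thompson_M C x y"
  have M: "?M = Inf ?S" by (simp add: thompson_M_def)
  \<comment> \<open>Since \<open>y\<close> is interior, it dominates small multiples of
    \<open>x\<close>; this produces an admissible factor.\<close>
  have "(\<lambda>n. y - (1 / real (Suc n)) *\<^sub>R x) \<longlonglongrightarrow> y - 0 *\<^sub>R x"
    by (intro tendsto_intros LIMSEQ_Suc[OF lim_const_over_n])
  then have "\<forall>\<^sub>F n in sequentially. y - (1 / real (Suc n)) *\<^sub>R x \<in> C"
    using topological_tendstoD[OF _ C_open] assms by auto
  then obtain n where "y - (1 / real (Suc n)) *\<^sub>R x \<in> C"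
    by (auto simp: eventually_sequentially)
  then have "real (Suc n) *\<^sub>R (y - (1 / real (Suc n)) *\<^sub>R x) \<in> K"
    by (intro C_imp_K C_scale) auto
  then have "real (Suc n) \<in> ?S" by (simp add: cone_le_def scaleR_diff_right)
  then have ne: "?S \<noteq> {}" by blast
  have bb: "bdd_below ?S" by (auto intro: bdd_belowI[of _ 0])
  have "closed ?T"
  proof -
    have "?T = {0..} \<inter> (\<lambda>l. l *\<^sub>R y - x) -` K" by auto
    then show ?thesis by (auto intro!: closed_Int closed_vimage continuous_intros)
  qed
  moreover have "?S \<subseteq> ?T" by (auto simp: cone_le_def)
  ultimately have "closure ?S \<subseteq> ?T" by (rule closure_minimal[rotated])
  then have MT: "?M \<in> ?T" using closure_contains_Inf[OF ne bb] M by auto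
  show pos: "?M > 0"
  proof (rule ccontr)
    assume "\<not> ?M > 0"
    then have "?M = 0" using MT by auto
    then have "- x \<in> K" using MT by simp
    then have "x = 0" using C_imp_K[OF assms(1)] by (intro K_pointed)
    then show False using assms by blast
  qed
  assume l: "l > 0"
  show "cone_le C x (l *\<^sub>R y) \<longleftrightarrow> ?M \<le> l"
  proof
    assume "cone_le C x (l *\<^sub>R y)"
    then show "?M \<le> l" unfolding M using l bb by (intro cInf_lower) auto
  next
    assume "?M \<le> l"
    then have "(?M *\<^sub>R y - x) + (l - ?M) *\<^sub>R y \<in> K"
      using MT assms(2) by (intro K_add K_scale[OF C_imp_K]) auto
    then show "cone_le C x (l *\<^sub>R y)" by (simp add: cone_le_def algebra_simps)
  qed
qed

lemma thompson_sym: "D x y = D y x"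
  by (simp add: thompson_dist_def max.commute)

lemma thompson_degenerate_dist:
  assumes "0 \<in> C" shows "D x y = 0"
proof -
  have "x \<in> K" for x using K_zero unfolding thompson_degenerate[OF assms, of x] .
  then have "K = UNIV" by blast
  \<comment> \<open>Every positive factor is admissible, so the infimum is 0, and
    \<open>ln 0\<close> has the default value 0.\<close>
  then have "thompson_M C x y = 0" for x y
    by (simp add: thompson_M_def cone_le_def greaterThan_def[symmetric])
  then show ?thesis by (simp add: thompson_dist_def)
qed

text \<open>Trades logarithms and infima for two closed conditions on the cone; the triangle
  inequality, measurability and compactness of balls are derived from this form.\<close>

lemma thompson_le_iff:
  assumes "x \<in> C" "y \<in> C" "r \<ge> 0"
  shows "D x y \<le> r \<longleftrightarrow> exp r *\<^sub>R y - x \<in> K \<and> exp r *\<^sub>R x - y \<in> K"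
proof (cases "0 \<in> C")
  case True
  then have "exp r *\<^sub>R y - x = 0" "exp r *\<^sub>R x - y = 0" using thompson_degenerate by blast+
  then show ?thesis using thompson_degenerate_dist[OF True] K_zero assms by auto
next
  case False
  have "D x y \<le> r \<longleftrightarrow> thompson_M C x y \<le> exp r \<and> thompson_M C y x \<le> exp r"
    using thompson_M_props(1)[OF _ _ False] assms
      ln_le_cancel_iff[of "thompson_M C x y" "exp r"] ln_le_cancel_iff[of "thompson_M C y x" "exp r"]
    by (simp add: thompson_dist_def)
  then show ?thesis
    using thompson_M_props(2)[OF _ _ False, of _ _ "exp r"] assms by (simp add: cone_le_def)
qed

text \<open>If both factors were at most some \<open>l < 1\<close>, adding the two inequalities
  would put \<open>(l - 1) *\<^sub>R (x + y)\<close> into the closure; adding the interior point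
  \<open>(1 - l) *\<^sub>R (x + y)\<close> would then place 0 in \<open>C\<close>.\<close>

lemma thompson_nonneg:
  assumes "x \<in> C" "y \<in> C" shows "D x y \<ge> 0"
proof (cases "0 \<in> C")
  case True
  then show ?thesis using thompson_degenerate_dist by simp
next
  case False
  show ?thesis
  proof (rule ccontr)
    assume "\<not> ?thesis"
    then have "thompson_M C x y < 1" "thompson_M C y x < 1"
      using thompson_M_props(1)[OF assms False] thompson_M_props(1)[OF assms(2,1) False]
      by (auto simp: thompson_dist_def not_le)
    then obtain l where l: "0 < l" "l < 1" "thompson_M C x y \<le> l" "thompson_M C y x \<le> l"
      using thompson_M_props(1)[OF assms False]
      by (intro that[of "max (thompson_M C x y) (thompson_M C y x)"]) auto
    then have "(l *\<^sub>R y - x) + (l *\<^sub>R x - y) \<in> K"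
      using thompson_M_props(2)[OF _ _ False l(1)] assms by (intro K_add) (auto simp: cone_le_def)
    moreover have "(1 - l) *\<^sub>R (x + y) \<in> C" using assms l by (intro C_scale C_add) auto
    ultimately have "((l *\<^sub>R y - x) + (l *\<^sub>R x - y)) + (1 - l) *\<^sub>R (x + y) \<in> C" by (rule K_add_C)
    then show False using False by (simp add: algebra_simps)
  qed
qed

lemma thompson_triangle:
  assumes "x \<in> C" "y \<in> C" "z \<in> C" shows "D x z \<le> D x y + D y z"
proof -
  have *: "exp (D x y + D y z) *\<^sub>R c - a \<in> K"
    if "exp (D x y) *\<^sub>R b - a \<in> K" "exp (D y z) *\<^sub>R c - b \<in> K" for a b c
  proof -
    have "(exp (D x y) *\<^sub>R b - a) + exp (D x y) *\<^sub>R (exp (D y z) *\<^sub>R c - b) \<in> K"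
      using that by (intro K_add K_scale) auto
    then show ?thesis by (simp add: exp_add scaleR_diff_right)
  qed
  have **: "exp (D x y + D y z) *\<^sub>R a - c \<in> K"
    if "exp (D x y) *\<^sub>R a - b \<in> K" "exp (D y z) *\<^sub>R b - c \<in> K" for a b c
  proof -
    have "(exp (D y z) *\<^sub>R b - c) + exp (D y z) *\<^sub>R (exp (D x y) *\<^sub>R a - b) \<in> K"
      using that by (intro K_add K_scale) auto
    then show ?thesis by (simp add: exp_add scaleR_diff_right mult.commute)
  qed
  show ?thesis
    using assms thompson_le_iff[of x y "D x y"] thompson_le_iff[of y z "D y z"]
      thompson_nonneg[of x y] thompson_nonneg[of y z]
      *[of y x z] **[of x y z]
    by (subst thompson_le_iff) auto
qed

section \<open>Measurability of the metric and its balls\<close>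

lemma space_N [simp]: "space N = C"
  by (simp add: space_restrict_space)

lemma sets_N: "A \<in> sets N \<longleftrightarrow> A \<subseteq> C \<and> A \<in> sets borel"
  using C_open by (subst sets_restrict_space_iff) auto

lemma thompson_measurable: "(\<lambda>w. D (fst w) (snd w)) \<in> borel_measurable (N \<Otimes>\<^sub>M N)"
  unfolding borel_measurable_iff_le
proof
  fix r :: real
  show "{w \<in> space (N \<Otimes>\<^sub>M N). D (fst w) (snd w) \<le> r} \<in> sets (N \<Otimes>\<^sub>M N)"
  proof (cases "r \<ge> 0")
    case True
    have id: "(\<lambda>x. x) \<in> measurable N borel" by (intro measurable_restrict_space1) simp
    have [measurable]: "fst \<in> measurable (N \<Otimes>\<^sub>M N) borel" "snd \<in> measurable (N \<Otimes>\<^sub>M N) borel"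
      using measurable_compose[OF measurable_fst id] measurable_compose[OF measurable_snd id] by auto
    have [measurable]: "K \<in> sets borel" by simp
    have "{w \<in> space (N \<Otimes>\<^sub>M N). D (fst w) (snd w) \<le> r} =
      {w \<in> space (N \<Otimes>\<^sub>M N). exp r *\<^sub>R snd w - fst w \<in> K \<and> exp r *\<^sub>R fst w - snd w \<in> K}"
      using thompson_le_iff True by (auto simp: space_pair_measure)
    also have "\<dots> \<in> sets (N \<Otimes>\<^sub>M N)" by measurable
    finally show ?thesis .
  next
    case False
    have "D (fst w) (snd w) \<ge> 0" if "w \<in> space (N \<Otimes>\<^sub>M N)" for w
      using that thompson_nonneg by (auto simp: space_pair_measure)
    then have "{w \<in> space (N \<Otimes>\<^sub>M N). D (fst w) (snd w) \<le> r} = {}"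
      using False by force
    then show ?thesis by (simp only: sets.empty_sets)
  qed
qed

lemma thompson_measurable_right: "x \<in> C \<Longrightarrow> D x \<in> borel_measurable N"
  using measurable_compose_Pair1[OF _ thompson_measurable, of x] by simp

text \<open>Lying above \<open>exp (- r) *\<^sub>R x\<close>, an interior point, already forces
  membership in \<open>C\<close>. So the ball is an order interval of the whole space and closed
  there, not only in \<open>C\<close>.\<close>

lemma thompson_ball_eq:
  assumes "x \<in> C" "r \<ge> 0"
  shows "{y\<in>C. D x y \<le> r} = {y. y - exp (- r) *\<^sub>R x \<in> K \<and> exp r *\<^sub>R x - y \<in> K}"
proof -
  have *: "exp r *\<^sub>R y - x \<in> K \<longleftrightarrow> y - exp (- r) *\<^sub>R x \<in> K" for y
    using K_scale_iff[of "exp r" "y - exp (- r) *\<^sub>R x"] by (simp add: scaleR_diff_right exp_minus)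
  have "y \<in> C" if "y - exp (- r) *\<^sub>R x \<in> K" for y
    using K_add_C[OF that, of "exp (- r) *\<^sub>R x"] C_scale[OF assms(1)] by simp
  then show ?thesis using assms thompson_le_iff * by auto
qed

text \<open>Normality converts the width of the order interval into a norm bound, with one constant
  for all centres and radii.\<close>

lemma thompson_ball_norm:
  "\<exists>c\<ge>0. \<forall>x\<in>C. \<forall>r\<ge>0. \<forall>y\<in>C. D x y \<le> r \<longrightarrow>
     norm (y - exp (- r) *\<^sub>R x) \<le> c * ((exp r - exp (- r)) * norm x)"
proof -
  obtain \<delta> where d: "\<delta> > 0" "\<And>x y. x \<in> K \<Longrightarrow> y \<in> K \<Longrightarrow> norm x * \<delta> \<le> norm (x + y)"
    using K_normal by blast
  show ?thesis
  proof (intro exI[of _ "1 / \<delta>"] conjI ballI allI impI)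
    fix x r y assume A: "x \<in> C" "0 \<le> r" "y \<in> C" "D x y \<le> r"
    then have "y - exp (- r) *\<^sub>R x \<in> K" "exp r *\<^sub>R x - y \<in> K"
      using thompson_ball_eq[of x r] by auto
    from d(2)[OF this] have "norm (y - exp (- r) *\<^sub>R x) * \<delta> \<le> norm ((exp r - exp (- r)) *\<^sub>R x)"
      by (simp add: algebra_simps)
    also have "\<dots> = (exp r - exp (- r)) * norm x" using A(2) by simp
    finally show "norm (y - exp (- r) *\<^sub>R x) \<le> 1 / \<delta> * ((exp r - exp (- r)) * norm x)"
      using d(1) by (simp add: field_simps)
  qed (use d in auto)
qed

lemma thompson_compact:
  assumes "x \<in> C" "r \<ge> 0" shows "compact {y\<in>C. D x y \<le> r}"
  unfolding compact_eq_bounded_closed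
proof
  obtain c where c: "\<And>y. y \<in> C \<Longrightarrow> D x y \<le> r \<Longrightarrow>
     norm (y - exp (- r) *\<^sub>R x) \<le> c * ((exp r - exp (- r)) * norm x)"
    using thompson_ball_norm assms by blast
  then have "{y\<in>C. D x y \<le> r} \<subseteq> cball (exp (- r) *\<^sub>R x) (c * ((exp r - exp (- r)) * norm x))"
    by (auto simp: dist_norm norm_minus_commute)
  then show "bounded {y\<in>C. D x y \<le> r}" using bounded_cball bounded_subset by blast
  have "{y. y - exp (- r) *\<^sub>R x \<in> K \<and> exp r *\<^sub>R x - y \<in> K} =
    (\<lambda>y. y - exp (- r) *\<^sub>R x) -` K \<inter> (\<lambda>y. exp r *\<^sub>R x - y) -` K" by auto
  also have "closed \<dots>" by (intro closed_Int closed_vimage continuous_intros closed_closure)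
  finally show "closed {y\<in>C. D x y \<le> r}" using thompson_ball_eq[OF assms] by simp
qed

text \<open>By \<open>thompson_ball_norm\<close> the norm size of a ball tends to 0 with its radius.
  This is what lets order intervals generate the norm-open sets.\<close>

lemma thompson_small_ball:
  assumes "x \<in> C" "open U" "x \<in> U"
  shows "\<exists>r>0. \<forall>y\<in>C. D x y \<le> r \<longrightarrow> y \<in> U"
proof -
  obtain e where e: "e > 0" "ball x e \<subseteq> U" using assms open_contains_ball by blast
  obtain c where c: "\<And>r y. r \<ge> 0 \<Longrightarrow> y \<in> C \<Longrightarrow> D x y \<le> r \<Longrightarrow>
     norm (y - exp (- r) *\<^sub>R x) \<le> c * ((exp r - exp (- r)) * norm x)"
    using thompson_ball_norm assms by blast
  let ?h = "\<lambda>r. c * ((exp r - exp (- r)) * norm x) + norm (exp (- r) *\<^sub>R x - x)"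
  have "isCont ?h 0" by (intro continuous_intros)
  then have "(?h \<longlongrightarrow> 0) (at 0)" unfolding isCont_def by simp
  then have "(?h \<longlongrightarrow> 0) (at_right 0)" by (rule filterlim_mono) (auto simp: at_le)
  then have "\<forall>\<^sub>F r in at_right 0. ?h r < e" using e(1) by (rule order_tendstoD)
  then have "\<forall>\<^sub>F r in at_right 0. ?h r < e \<and> r > 0"
    by (intro eventually_conj eventually_at_right_less)
  then obtain r where r: "?h r < e" "r > 0" using eventually_happens[of _ "at_right (0::real)"] by auto
  have "y \<in> U" if "y \<in> C" "D x y \<le> r" for y
  proof -
    have "norm (y - x) \<le> norm (y - exp (- r) *\<^sub>R x) + norm (exp (- r) *\<^sub>R x - x)"
      by (metis add.commute diff_add_cancel diff_add_eq diff_diff_eq2 norm_triangle_ineq)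
    also have "\<dots> \<le> ?h r" using c[OF _ that] r by simp
    finally have "y \<in> ball x e" using r by (simp add: dist_norm norm_minus_commute)
    then show ?thesis using e by blast
  qed
  then show ?thesis using r by blast
qed

subsection \<open>Upper and lower sets\<close>

text \<open>Both orders are treated at once: \<^term>\<open>s = 1\<close> gives the open upper sets and
  \<^term>\<open>s = -1\<close> the open lower sets, and the masses of a monotone sequence of measures
  increase on one of the two families.\<close>

definition upsets :: "real \<Rightarrow> 'a set set" where
  "upsets s = {U. open U \<and> U \<subseteq> C \<and> (\<forall>x\<in>U. \<forall>y\<in>C. s *\<^sub>R (y - x) \<in> K \<longrightarrow> y \<in> U)}"

lemma upsets_1: "U \<in> upsets 1 \<longleftrightarrow> open U \<and> upper_set_in C U"
  by (auto simp: upsets_def upper_set_in_def cone_le_def)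

lemma upsetsD: "U \<in> upsets s \<Longrightarrow> x \<in> U \<Longrightarrow> y \<in> C \<Longrightarrow> s *\<^sub>R (y - x) \<in> K \<Longrightarrow> y \<in> U"
  and upsets_subset: "U \<in> upsets s \<Longrightarrow> U \<subseteq> C"
  and upsets_open: "U \<in> upsets s \<Longrightarrow> open U"
  by (auto simp: upsets_def)

lemma upsets_sets: "U \<in> upsets s \<Longrightarrow> U \<in> sets N"
  using upsets_subset upsets_open by (auto simp: sets_N)

lemma upsets_Un: "U \<in> upsets s \<Longrightarrow> V \<in> upsets s \<Longrightarrow> U \<union> V \<in> upsets s"
  and upsets_Int: "U \<in> upsets s \<Longrightarrow> V \<in> upsets s \<Longrightarrow> U \<inter> V \<in> upsets s"
  and upsets_empty: "{} \<in> upsets s"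
  and upsets_C: "C \<in> upsets s"
  using C_open by (auto simp: upsets_def)

text \<open>Dilating an up-set by a factor close to 1 moves its closure inside the up-set, because
  \<open>z\<close> lies strictly above \<open>c *\<^sub>R z\<close> for \<open>0 < c < 1\<close>.\<close>

lemma upsets_inner_approximation:
  assumes s: "s = 1 \<or> s = -1" and U: "U \<in> upsets s"
  shows "\<exists>F::nat \<Rightarrow> 'a set. incseq F \<and> (\<Union>k. F k) = U \<and> (\<forall>k. F k \<in> upsets s \<and> closure (F k) \<inter> C \<subseteq> U)"
proof -
  \<comment> \<open>For \<open>s = -1\<close> the factor exceeds 1, so that again
    \<open>s *\<^sub>R (z - c k *\<^sub>R z)\<close> is a positive multiple of \<open>z\<close>. The
    offset 2 keeps the factor positive for \<open>s = 1\<close> and \<open>k = 0\<close>.\<close>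
  define c where "c k = 1 - s / real (k + 2)" for k :: nat
  have c_pos: "c k > 0" for k using s by (auto simp: c_def field_simps)
  have ss: "s * s = 1" using s by auto
  define F where "F k = {z\<in>C. c k *\<^sub>R z \<in> U}" for k
  have up: "F k \<in> upsets s" for k
    unfolding upsets_def
  proof (rule CollectI, intro conjI ballI impI)
    have "F k = C \<inter> (\<lambda>z. c k *\<^sub>R z) -` U" by (auto simp: F_def)
    then show "open (F k)"
      using C_open upsets_open[OF U] by (auto intro!: open_Int open_vimage continuous_intros)
    show "F k \<subseteq> C" by (auto simp: F_def)
    fix x y assume xy: "x \<in> F k" "y \<in> C" "s *\<^sub>R (y - x) \<in> K"
    have "s *\<^sub>R (c k *\<^sub>R y - c k *\<^sub>R x) = c k *\<^sub>R (s *\<^sub>R (y - x))" by (simp add: algebra_simps)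
    also have "\<dots> \<in> K" by (rule K_scale[OF xy(3) less_imp_le[OF c_pos]])
    finally have "c k *\<^sub>R y \<in> U"
      using xy(1) C_scale[OF xy(2) c_pos] by - (rule upsetsD[OF U, of "c k *\<^sub>R x"], auto simp: F_def)
    then show "y \<in> F k" using xy by (simp add: F_def)
  qed
  have mono: "F k \<subseteq> F l" if "k \<le> l" for k l
  proof
    fix z assume z: "z \<in> F k"
    have "s * (c l - c k) = 1 / real (k + 2) - 1 / real (l + 2)"
      using ss by (simp add: c_def right_diff_distrib)
    then have "s *\<^sub>R (c l *\<^sub>R z - c k *\<^sub>R z) = (1 / real (k + 2) - 1 / real (l + 2)) *\<^sub>R z"
      by (metis scaleR_left_diff_distrib scaleR_scaleR)
    also have "\<dots> \<in> K"
      using z that by (intro K_scale C_imp_K) (auto simp: F_def field_simps)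
    finally have "c l *\<^sub>R z \<in> U"
      using z C_scale[OF _ c_pos] by - (rule upsetsD[OF U, of "c k *\<^sub>R z"], auto simp: F_def)
    then show "z \<in> F l" using z by (simp add: F_def)
  qed
  have cl: "closure (F k) \<inter> C \<subseteq> U" for k
  proof
    fix z assume z: "z \<in> closure (F k) \<inter> C"
    \<comment> \<open>\<open>G\<close> is a neighbourhood of \<open>z\<close> whose points, once
      dilated, still lie strictly below \<open>z\<close> in the order given by \<open>s\<close>; it
      meets \<open>F k\<close>.\<close>
    define G where "G = (\<lambda>y. s *\<^sub>R (z - c k *\<^sub>R y)) -` C"
    have "open G" unfolding G_def using C_open by (intro open_vimage continuous_intros)
    have "s * (1 - c k) = 1 / real (k + 2)" using ss by (simp add: c_def)
    then have "s *\<^sub>R (z - c k *\<^sub>R z) = (1 / real (k + 2)) *\<^sub>R z"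
      by (metis scaleR_left_diff_distrib scaleR_one scaleR_scaleR)
    also have "\<dots> \<in> C" using z by (intro C_scale) auto
    finally have "z \<in> G" by (simp add: G_def)
    then obtain y where y: "y \<in> F k" "y \<in> G"
      using z \<open>open G\<close> open_Int_closure_eq_empty[of G "F k"] by blast
    then show "z \<in> U"
      using z C_imp_K by - (rule upsetsD[OF U, of "c k *\<^sub>R y"], auto simp: F_def G_def)
  qed
  have "U \<subseteq> (\<Union>k. F k)"
  proof
    fix z assume z: "z \<in> U"
    have "(\<lambda>k. (1 - s * (1 / real (k + 2))) *\<^sub>R z) \<longlonglongrightarrow> (1 - s * 0) *\<^sub>R z"
      by (intro tendsto_intros LIMSEQ_ignore_initial_segment[OF lim_const_over_n])
    then have "(\<lambda>k. c k *\<^sub>R z) \<longlonglongrightarrow> z" by (simp add: c_def)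
    then have "\<forall>\<^sub>F k in sequentially. c k *\<^sub>R z \<in> U"
      using topological_tendstoD upsets_open[OF U] z by blast
    then obtain k where "c k *\<^sub>R z \<in> U" by (auto simp: eventually_sequentially)
    then show "z \<in> (\<Union>k. F k)" using z upsets_subset[OF U] by (auto simp: F_def)
  qed
  moreover have "F k \<subseteq> U" for k
    using cl[of k] closure_subset[of "F k"] upsets_subset[OF up[of k]] by blast
  ultimately have "(\<Union>k. F k) = U" by blast
  then show ?thesis
    using up cl mono by (intro exI[of _ F]) (auto intro: incseq_def[THEN iffD2])
qed

text \<open>Within \<open>C\<close> the closure of an up-set stays closed upwards: a sequence
  approximating \<open>y\<close> is translated by \<open>x - y\<close>, and since \<open>C\<close>
  is open the translates eventually remain in \<open>C\<close>.\<close>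

lemma upsets_closure_complement:
  assumes U: "U \<in> upsets s" shows "C - closure U \<in> upsets (- s)"
  unfolding upsets_def
proof (rule CollectI, intro conjI ballI impI)
  show "open (C - closure U)" using C_open by (simp add: open_Diff)
  fix x y assume xy: "x \<in> C - closure U" "y \<in> C" "(- s) *\<^sub>R (y - x) \<in> K"
  have "x \<in> closure U" if y: "y \<in> closure U"
  proof -
    obtain f where f: "\<forall>n. f n \<in> U" "f \<longlonglongrightarrow> y" using y unfolding closure_sequential by blast
    have "(\<lambda>n. f n + (x - y)) \<longlonglongrightarrow> y + (x - y)" by (intro tendsto_intros f)
    then have lim: "(\<lambda>n. f n + (x - y)) \<longlonglongrightarrow> x" by simp
    then have "\<forall>\<^sub>F n in sequentially. f n + (x - y) \<in> C"
      using topological_tendstoD[OF _ C_open] xy(1) by blast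
    then have ev: "\<forall>\<^sub>F n in sequentially. f n + (x - y) \<in> closure U"
    proof eventually_elim
      case (elim n)
      have "s *\<^sub>R (f n + (x - y) - f n) \<in> K" using xy(3) by (simp add: algebra_simps)
      then show ?case using upsetsD[OF U f(1)[rule_format] elim] closure_subset by blast
    qed
    show ?thesis by (rule Lim_in_closed_set[OF closed_closure ev _ lim]) simp
  qed
  then show "y \<in> C - closure U" using xy by blast
qed auto

lemma borel_probD:
  assumes "m \<in> borel_prob C"
  shows "prob_space m" "sets m = sets N" "space m = C"
  using assms sets_eq_imp_space_eq[of m N] by (auto simp: borel_prob_def)

text \<open>Complementation would need open complements. Instead \<open>W\<close> is exhausted by
  sets whose closures stay in \<open>W\<close>; the complement of such a closure is an open up-set
  of the other kind, to which \<open>le\<close> applies.\<close>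

lemma upsets_reverse:
  assumes s: "s = 1 \<or> s = -1" and m: "m \<in> borel_prob C" "m' \<in> borel_prob C"
    and le: "\<And>U. U \<in> upsets s \<Longrightarrow> measure m U \<le> measure m' U"
    and W: "W \<in> upsets (- s)"
  shows "measure m' W \<le> measure m W"
proof -
  interpret m: prob_space m by (rule borel_probD(1)[OF m(1)])
  interpret m': prob_space m' by (rule borel_probD(1)[OF m(2)])
  note [simp] = borel_probD[OF m(1)] borel_probD[OF m(2)]
  obtain F :: "nat \<Rightarrow> 'a set" where F: "incseq F" "(\<Union>k. F k) = W"
    "\<And>k. F k \<in> upsets (- s)" "\<And>k. closure (F k) \<inter> C \<subseteq> W"
    using upsets_inner_approximation[OF _ W] s by auto
  have "measure m' (F k) \<le> measure m W" for k
  proof -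
    have G: "C - closure (F k) \<in> upsets s" using upsets_closure_complement[OF F(3)] by simp
    have sets: "closure (F k) \<inter> C \<in> sets N" using C_open by (auto simp: sets_N)
    have eq: "C - (closure (F k) \<inter> C) = C - closure (F k)" by blast
    have "measure m' (F k) \<le> measure m' (closure (F k) \<inter> C)"
      using closure_subset[of "F k"] upsets_subset[OF F(3)[of k]] sets
      by (intro m'.finite_measure_mono) auto
    also have "\<dots> = 1 - measure m' (C - closure (F k))"
      using m'.prob_compl[of "closure (F k) \<inter> C"] sets eq by simp
    also have "\<dots> \<le> 1 - measure m (C - closure (F k))" using le[OF G] by simp
    also have "\<dots> = measure m (closure (F k) \<inter> C)"
      using m.prob_compl[of "closure (F k) \<inter> C"] sets eq by simp
    also have "\<dots> \<le> measure m W"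
      using F(4) upsets_sets[OF W] by (intro m.finite_measure_mono) auto
    finally show ?thesis .
  qed
  moreover have "(\<lambda>k. measure m' (F k)) \<longlonglongrightarrow> measure m' W"
    using m'.finite_Lim_measure_incseq[of F] F upsets_sets[OF F(3)] by auto
  ultimately show ?thesis by (intro LIMSEQ_le_const2) auto
qed

section \<open>Half-open order intervals as cells\<close>

text \<open>One end is strict, giving an open up-set, and the other is not, giving the complement of
  one; so a cell is a difference of two up-sets. Changing the sign of \<open>s\<close> exchanges the
  two ends.\<close>

definition cell :: "real \<Rightarrow> 'a \<Rightarrow> real \<Rightarrow> 'a set" where
  "cell s x t = {y\<in>C. s *\<^sub>R (y - exp (- s * t) *\<^sub>R x) \<in> C \<and> s *\<^sub>R (exp (s * t) *\<^sub>R x - y) \<in> K}"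

lemma upsets_strictly_above: "{y\<in>C. s *\<^sub>R (y - a) \<in> C} \<in> upsets s"
  unfolding upsets_def
proof (rule CollectI, intro conjI ballI impI)
  have "{y\<in>C. s *\<^sub>R (y - a) \<in> C} = C \<inter> (\<lambda>y. s *\<^sub>R (y - a)) -` C" by auto
  then show "open {y\<in>C. s *\<^sub>R (y - a) \<in> C}"
    using C_open by (auto intro!: open_Int open_vimage continuous_intros)
  fix x y assume xy: "x \<in> {y \<in> C. s *\<^sub>R (y - a) \<in> C}" "y \<in> C" "s *\<^sub>R (y - x) \<in> K"
  then have "s *\<^sub>R (y - x) + s *\<^sub>R (x - a) \<in> C" by (intro K_add_C) auto
  moreover have "s *\<^sub>R (y - x) + s *\<^sub>R (x - a) = s *\<^sub>R (y - a)" by (simp add: algebra_simps)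
  ultimately show "y \<in> {y \<in> C. s *\<^sub>R (y - a) \<in> C}" using xy(2) by simp
qed auto

text \<open>The factor \<open>t\<close> lets the same statement cover both halves of
  \<open>thompson_gt_eq\<close>, where it is 1 and an exponential.\<close>

lemma upsets_not_below:
  assumes "t \<ge> 0" shows "{y\<in>C. s *\<^sub>R (a - t *\<^sub>R y) \<notin> K} \<in> upsets s"
  unfolding upsets_def
proof (rule CollectI, intro conjI ballI impI)
  have "{y\<in>C. s *\<^sub>R (a - t *\<^sub>R y) \<notin> K} = C \<inter> (\<lambda>y. s *\<^sub>R (a - t *\<^sub>R y)) -` (- K)" by auto
  then show "open {y\<in>C. s *\<^sub>R (a - t *\<^sub>R y) \<notin> K}"
    using C_open by (auto intro!: open_Int open_vimage continuous_intros)
  fix x y assume xy: "x \<in> {y \<in> C. s *\<^sub>R (a - t *\<^sub>R y) \<notin> K}" "y \<in> C" "s *\<^sub>R (y - x) \<in> K"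
  have "s *\<^sub>R (a - t *\<^sub>R x) \<in> K" if "s *\<^sub>R (a - t *\<^sub>R y) \<in> K"
  proof -
    have "s *\<^sub>R (a - t *\<^sub>R y) + t *\<^sub>R (s *\<^sub>R (y - x)) \<in> K"
      by (rule K_add[OF that K_scale[OF xy(3) assms]])
    then show ?thesis by (simp add: algebra_simps)
  qed
  then show "y \<in> {y \<in> C. s *\<^sub>R (a - t *\<^sub>R y) \<notin> K}" using xy by auto
qed auto

lemma cell_Diff: "\<exists>P\<in>upsets s. \<exists>Q\<in>upsets s. cell s x t = P - Q"
  using upsets_not_below[of 1 s "exp (s * t) *\<^sub>R x"]
  by (intro bexI[OF _ upsets_strictly_above[of s "exp (- s * t) *\<^sub>R x"]] bexI) (auto simp: cell_def)

lemma cell_subset_ball: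
  assumes s: "s = 1 \<or> s = -1" and x: "x \<in> C" "t \<ge> 0" and y: "y \<in> cell s x t"
  shows "D x y \<le> t"
  using s y thompson_ball_eq[OF x] C_imp_K by (auto simp: cell_def)

lemma ball_subset_cell:
  assumes s: "s = 1 \<or> s = -1" and x: "x \<in> C" "y \<in> C" "D x y < t"
  shows "y \<in> cell s x t"
proof -
  let ?r = "D x y"
  have r: "?r \<ge> 0" using thompson_nonneg x by simp
  then have "y - exp (- ?r) *\<^sub>R x \<in> K" "exp ?r *\<^sub>R x - y \<in> K"
    using thompson_ball_eq[of x ?r] x by auto
  \<comment> \<open>The slack between \<open>D x y\<close> and \<open>t\<close> makes both ends
    strict, so either sign of \<open>s\<close> is served.\<close>
  moreover have "(exp (- ?r) - exp (- t)) *\<^sub>R x \<in> C" "(exp t - exp ?r) *\<^sub>R x \<in> C"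
    using x by (auto intro!: C_scale)
  ultimately have "y - exp (- ?r) *\<^sub>R x + (exp (- ?r) - exp (- t)) *\<^sub>R x \<in> C"
    "exp ?r *\<^sub>R x - y + (exp t - exp ?r) *\<^sub>R x \<in> C"
    by (auto intro!: K_add_C)
  then have "y - exp (- t) *\<^sub>R x \<in> C" "exp t *\<^sub>R x - y \<in> C" by (simp_all add: algebra_simps)
  then show ?thesis using s x C_imp_K by (auto simp: cell_def)
qed

text \<open>Cells are not open in general; covering arguments use this open core instead.\<close>

lemma cell_nbhd:
  assumes s: "s = 1 \<or> s = -1" and x: "x \<in> C" "t > 0"
  shows "\<exists>O'. open O' \<and> x \<in> O' \<and> O' \<subseteq> cell s x t"
proof (intro exI conjI)
  let ?O = "C \<inter> (\<lambda>y. y - exp (- t) *\<^sub>R x) -` C \<inter> (\<lambda>y. exp t *\<^sub>R x - y) -` C"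
  show "open ?O" using C_open by (intro open_Int open_vimage continuous_intros)
  have "(1 - exp (- t)) *\<^sub>R x \<in> C" "(exp t - 1) *\<^sub>R x \<in> C" using x by (auto intro!: C_scale)
  then show "x \<in> ?O" using x by (simp add: algebra_simps)
  show "?O \<subseteq> cell s x t" using s C_imp_K by (auto simp: cell_def)
qed

text \<open>Each point of an open set has a cell around it inside that set. Lindelof applied to open
  cores of these cells writes the open set as a countable union of cells.\<close>

lemma sets_N_eq_sigma_upsets:
  assumes s: "s = 1 \<or> s = -1"
  shows "sigma_sets C {U - V |U V. U \<in> upsets s \<and> V \<in> upsets s} = sets N" (is "sigma_sets C ?S = _")
proof
  have "?S \<subseteq> sets N" using upsets_sets by blast
  then show "sigma_sets C ?S \<subseteq> sets N" using sets.sigma_sets_subset[of ?S N] by simp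
  have op: "A \<in> sigma_sets C ?S" if A: "open A" "A \<subseteq> C" for A
  proof -
    define R where "R x O' B \<longleftrightarrow> open O' \<and> x \<in> O' \<and> O' \<subseteq> B \<and> B \<subseteq> A \<and> B \<in> ?S" for x O' B
    have "\<exists>O' B. R x O' B" if x: "x \<in> A" for x
    proof -
      obtain r where r: "r > 0" "\<And>y. y \<in> C \<Longrightarrow> D x y \<le> r \<Longrightarrow> y \<in> A"
        using thompson_small_ball[of x A] x A by blast
      then have sub: "cell s x r \<subseteq> A"
        using cell_subset_ball[OF s _ less_imp_le[OF r(1)]] x A by (auto simp: cell_def)
      have mem: "cell s x r \<in> ?S" using cell_Diff[of s x r] by blast
      obtain O' where "open O'" "x \<in> O'" "O' \<subseteq> cell s x r"
        using cell_nbhd[OF s _ r(1)] x A(2) by (metis subsetD)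
      then show ?thesis unfolding R_def
        by (intro exI[of _ O'] exI[of _ "cell s x r"] conjI sub mem)
    qed
    then obtain O' B where "\<And>x. x \<in> A \<Longrightarrow> R x (O' x) (B x)" by metis
    then have OB: "open (O' x)" "x \<in> O' x" "O' x \<subseteq> B x" "B x \<subseteq> A" "B x \<in> ?S" if "x \<in> A" for x
      using that unfolding R_def by blast+
    obtain F' where F': "F' \<subseteq> O' ` A" "countable F'" "\<Union>F' = \<Union>(O' ` A)"
      using Lindelof[of "O' ` A"] OB by auto
    then obtain I where I: "I \<subseteq> A" "countable I" "F' = O' ` I"
      using countable_subset_image[of F' O' A] by auto
    have A_eq: "A = \<Union>(O' ` A)"
    proof
      show "A \<subseteq> \<Union>(O' ` A)" using OB(2) by blast
      show "\<Union>(O' ` A) \<subseteq> A" using OB(3,4) by blast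
    qed
    have "A = (\<Union>x\<in>I. B x)"
    proof
      have "A = \<Union>(O' ` I)" using A_eq F'(3) I(3) by simp
      also have "\<dots> \<subseteq> (\<Union>x\<in>I. B x)" using I(1) OB(3) by (intro UN_mono) auto
      finally show "A \<subseteq> (\<Union>x\<in>I. B x)" by simp
      show "(\<Union>x\<in>I. B x) \<subseteq> A" by (rule UN_least, rule OB(4)) (use I(1) in blast)
    qed
    moreover have "(\<Union>x\<in>I. B x) \<in> sigma_sets C ?S"
    proof (rule sigma_sets_UNION)
      show "countable (B ` I)" using I(2) by (rule countable_image)
      fix b assume "b \<in> B ` I"
      then obtain x where x: "x \<in> I" "b = B x" by blast
      have "B x \<in> ?S" by (rule OB(5)) (use x(1) I(1) in blast)
      then show "b \<in> sigma_sets C ?S" unfolding x(2) by (rule sigma_sets.Basic)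
    qed
    ultimately show ?thesis by (simp only:)
  qed
  have "(\<inter>) C ` sigma_sets UNIV {A. open A} = sigma_sets C ((\<inter>) C ` {A. open A})"
    using C_open by (intro sigma_sets_Int) (auto intro: sigma_sets.Basic)
  also have "\<dots> \<subseteq> sigma_sets C ?S"
    using op C_open by (intro sigma_sets_mono) auto
  finally show "sets N \<subseteq> sigma_sets C ?S"
    by (simp add: sets_restrict_space sets_borel)
qed

lemma thompson_gt_eq:
  assumes "x \<in> C" "t \<ge> 0"
  shows "{y\<in>C. D x y > t} = {y\<in>C. 1 *\<^sub>R (exp t *\<^sub>R x - 1 *\<^sub>R y) \<notin> K} \<union> {y\<in>C. (-1) *\<^sub>R (x - exp t *\<^sub>R y) \<notin> K}"
  using thompson_le_iff[OF assms(1) _ assms(2)] by (auto simp: not_le[symmetric])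

text \<open>The far region is the union of an upper and a lower set, so its mass under a measure
  squeezed between \<^term>\<open>m1\<close> and \<^term>\<open>m2\<close> is controlled by both ends.\<close>

lemma thompson_tail_le:
  assumes m: "m1 \<in> borel_prob C" "m \<in> borel_prob C" "m2 \<in> borel_prob C"
    and le: "stoch_le C m1 m" "stoch_le C m m2" and x: "x \<in> C" and t: "t \<ge> 0"
  shows "measure m {y\<in>C. D x y > t} \<le> measure m1 {y\<in>C. D x y > t} + measure m2 {y\<in>C. D x y > t}"
proof -
  let ?U = "{y\<in>C. 1 *\<^sub>R (exp t *\<^sub>R x - 1 *\<^sub>R y) \<notin> K}"
  let ?W = "{y\<in>C. (-1) *\<^sub>R (x - exp t *\<^sub>R y) \<notin> K}"
  have U: "?U \<in> upsets 1" by (rule upsets_not_below) simp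
  have W: "?W \<in> upsets (-1)" by (rule upsets_not_below) simp
  interpret m1: prob_space m1 by (rule borel_probD(1)[OF m(1)])
  interpret m: prob_space m by (rule borel_probD(1)[OF m(2)])
  interpret m2: prob_space m2 by (rule borel_probD(1)[OF m(3)])
  note [simp] = borel_probD[OF m(1)] borel_probD[OF m(2)] borel_probD[OF m(3)]
  have eq: "{y\<in>C. D x y > t} = ?U \<union> ?W" using thompson_gt_eq[OF x t] .
  have "measure m (?U \<union> ?W) \<le> measure m ?U + measure m ?W"
    using upsets_sets[OF U] upsets_sets[OF W] by (intro measure_Un_le) auto
  also have "measure m ?U \<le> measure m2 ?U"
    using le(2) U by (simp add: stoch_le_def upsets_1)
  also have "\<dots> \<le> measure m2 (?U \<union> ?W)"
    using upsets_sets[OF U] upsets_sets[OF W] by (intro m2.finite_measure_mono) auto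
  also have "measure m ?W \<le> measure m1 ?W"
    using le(1) by (intro upsets_reverse[OF _ m(1,2) _ W]) (auto simp: stoch_le_def upsets_1)
  also have "\<dots> \<le> measure m1 (?U \<union> ?W)"
    using upsets_sets[OF U] upsets_sets[OF W] by (intro m1.finite_measure_mono) auto
  finally show ?thesis unfolding eq by simp
qed

subsection \<open>The limit measure\<close>

definition diffs :: "real \<Rightarrow> 'a set set" where
  "diffs s = {U - V |U V. U \<in> upsets s \<and> V \<in> upsets s}"

lemma diffsI: "U \<in> upsets s \<Longrightarrow> V \<in> upsets s \<Longrightarrow> U - V \<in> diffs s"
  by (auto simp: diffs_def)

definition ring :: "real \<Rightarrow> 'a set set" where
  "ring s = semiring_of_sets.generated_ring (diffs s)"

lemma semiring_diffs: "semiring_of_sets C (diffs s)"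
proof
  show "diffs s \<subseteq> Pow C" using upsets_subset by (auto simp: diffs_def)
  show "{} \<in> diffs s" using upsets_empty by (auto simp: diffs_def)
  fix a b assume "a \<in> diffs s" "b \<in> diffs s"
  then obtain U V U' V' where ab: "a = U - V" "b = U' - V'"
    and up: "U \<in> upsets s" "V \<in> upsets s" "U' \<in> upsets s" "V' \<in> upsets s"
    by (auto simp: diffs_def)
  have eq: "a \<inter> b = (U \<inter> U') - (V \<union> V')" using ab by blast
  show "a \<inter> b \<in> diffs s"
    unfolding eq by (intro diffsI upsets_Int upsets_Un up)
  \<comment> \<open>A point of \<open>a - b\<close> either avoids \<open>U'\<close> or lies in both
    \<open>U'\<close> and \<open>V'\<close>; this splits it into two disjoint differences of
    up-sets.\<close>
  let ?X = "U - (V \<union> U')" and ?Y = "(U \<inter> (U' \<inter> V')) - V"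
  have "?X \<in> diffs s" "?Y \<in> diffs s"
    by (intro diffsI upsets_Int upsets_Un up)+
  then have "{?X, ?Y} \<subseteq> diffs s" by simp
  moreover have "disjoint {?X, ?Y}" by (auto simp: disjoint_def)
  moreover have "a - b = \<Union>{?X, ?Y}" using ab by auto
  ultimately show "\<exists>\<C>\<subseteq>diffs s. finite \<C> \<and> disjoint \<C> \<and> a - b = \<Union>\<C>"
    by (intro exI[of _ "{?X, ?Y}"]) simp
qed

lemma ring_of_sets_ring: "ring_of_sets C (ring s)"
  unfolding ring_def by (rule semiring_of_sets.generating_ring[OF semiring_diffs])

lemma diffs_subset_ring: "diffs s \<subseteq> ring s"
  unfolding ring_def using semiring_of_sets.generated_ringI_Basic[OF semiring_diffs] by blast

lemma upsets_subset_ring: "upsets s \<subseteq> ring s"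
proof
  fix U assume "U \<in> upsets s"
  then have "U - {} \<in> diffs s" using upsets_empty by (rule diffsI)
  then show "U \<in> ring s" using diffs_subset_ring by auto
qed

lemma cell_in_ring: "cell s x t \<in> ring s"
  using cell_Diff[of s x t] diffs_subset_ring by (auto simp: diffs_def)

lemma sets_N_eq_sigma_ring:
  assumes "s = 1 \<or> s = -1" shows "sigma_sets C (ring s) = sets N"
  unfolding ring_def semiring_of_sets.sigma_sets_generated_ring_eq[OF semiring_diffs]
  using sets_N_eq_sigma_upsets[OF assms] by (simp add: diffs_def)

lemma ring_induct [consumes 1, case_names empty diff Un]:
  assumes A: "A \<in> ring s" and "P {}"
    and "\<And>U V. U \<in> upsets s \<Longrightarrow> V \<in> upsets s \<Longrightarrow> P (U - V)"
    and Un: "\<And>A B. A \<in> ring s \<Longrightarrow> B \<in> ring s \<Longrightarrow> A \<inter> B = {} \<Longrightarrow> P A \<Longrightarrow> P B \<Longrightarrow> P (A \<union> B)"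
  shows "P A"
proof -
  interpret R: ring_of_sets C "ring s" by (rule ring_of_sets_ring)
  obtain \<C> where \<C>: "finite \<C>" "disjoint \<C>" "\<C> \<subseteq> diffs s" "A = \<Union>\<C>"
    using semiring_of_sets.generated_ringE[OF semiring_diffs] A unfolding ring_def by metis
  from \<C>(1-3) have "\<Union>\<C> \<in> ring s \<and> P (\<Union>\<C>)"
  proof (induction \<C> rule: finite_induct)
    case empty
    then show ?case using assms(2) by simp
  next
    case (insert S \<C>)
    then have IH: "\<Union>\<C> \<in> ring s" "P (\<Union>\<C>)" by (auto simp: pairwise_insert)
    have "S \<in> diffs s" using insert by simp
    then have S: "S \<in> ring s" "P S"
      using assms(3) diffs_subset_ring[of s] by (blast, auto simp: diffs_def)
    have "S \<inter> \<Union>\<C> = {}" using insert by (auto simp: disjoint_def)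
    then show ?case using IH S Un[of S "\<Union>\<C>"] by auto
  qed
  then show ?thesis using \<C>(4) by simp
qed

lemma ring_sets:
  assumes "A \<in> ring s" shows "A \<in> sets N"
  using assms by (induction rule: ring_induct) (auto simp: upsets_sets)

text \<open>The mass of \<open>U - V\<close> is that of \<open>U\<close> minus that of
  \<open>U \<inter> V\<close>, and both are up-sets; additivity then reaches every finite disjoint
  union.\<close>

lemma ring_LIMSEQ:
  fixes M :: "nat \<Rightarrow> 'a measure"
  assumes M: "\<And>n. M n \<in> borel_prob C" and m: "m \<in> borel_prob C"
    and lim: "\<And>U. U \<in> upsets s \<Longrightarrow> (\<lambda>n. measure (M n) U) \<longlonglongrightarrow> measure m U"
    and A: "A \<in> ring s"
  shows "(\<lambda>n. measure (M n) A) \<longlonglongrightarrow> measure m A"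
  using A
proof (induction rule: ring_induct)
  case (diff U V)
  have *: "measure m' (U - V) = measure m' U - measure m' (U \<inter> V)" if "m' \<in> borel_prob C" for m'
  proof -
    interpret prob_space m' by (rule borel_probD(1)[OF that])
    show ?thesis
      using finite_measure_Diff'[of U V] upsets_sets diff borel_probD[OF that] by auto
  qed
  show ?case unfolding *[OF M] *[OF m] using upsets_Int diff by (intro tendsto_diff lim)
next
  case (Un A B)
  have *: "measure m' (A \<union> B) = measure m' A + measure m' B" if "m' \<in> borel_prob C" for m'
  proof -
    interpret prob_space m' by (rule borel_probD(1)[OF that])
    show ?thesis
      using finite_measure_Union[of A B] ring_sets Un borel_probD[OF that] by auto
  qed
  show ?case unfolding *[OF M] *[OF m] using Un by (intro tendsto_add)
qed simp

lemma ring_convergent: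
  fixes M :: "nat \<Rightarrow> 'a measure"
  assumes M: "\<And>n. M n \<in> borel_prob C"
    and mono: "\<And>n U. U \<in> upsets s \<Longrightarrow> measure (M n) U \<le> measure (M (Suc n)) U"
    and A: "A \<in> ring s"
  shows "convergent (\<lambda>n. measure (M n) A)"
  using A
proof (induction rule: ring_induct)
  case (diff U V)
  have *: "measure (M n) (U - V) = measure (M n) U - measure (M n) (U \<inter> V)" for n
  proof -
    interpret prob_space "M n" by (rule borel_probD(1)[OF M])
    show ?thesis
      using finite_measure_Diff'[of U V] upsets_sets diff borel_probD[OF M] by auto
  qed
  have "convergent (\<lambda>n. measure (M n) W)" if "W \<in> upsets s" for W
  proof (rule Bseq_mono_convergent)
    have "measure (M n) W \<le> 1" for n
      using prob_space.prob_le_1[OF borel_probD(1)[OF M]] .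
    then show "Bseq (\<lambda>n. measure (M n) W)" by (intro BseqI[of 1]) auto
    show "\<forall>m n. m \<le> n \<longrightarrow> measure (M m) W \<le> measure (M n) W"
      using mono[OF that] lift_Suc_mono_le[of "\<lambda>n. measure (M n) W"] by blast
  qed
  then show ?case unfolding * using upsets_Int diff by (intro convergent_diff) auto
next
  case (Un A B)
  have *: "measure (M n) (A \<union> B) = measure (M n) A + measure (M n) B" for n
  proof -
    interpret prob_space "M n" by (rule borel_probD(1)[OF M])
    show ?thesis
      using finite_measure_Union[of A B] ring_sets Un borel_probD[OF M] by auto
  qed
  show ?case unfolding * using Un by (intro convergent_add)
qed (simp add: convergent_const)

text \<open>The limit content on the ring is countably additive because every ring set is approximated
  from inside by a compact set: only the positive part of a difference of up-sets has to be shrunk,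
  as the complement of an up-set is already closed in \<^term>\<open>C\<close>.\<close>

lemma ring_inner_compact:
  fixes M :: "nat \<Rightarrow> 'a measure"
  assumes s: "s = 1 \<or> s = -1" and M: "\<And>n. M n \<in> borel_prob C"
    and mono: "\<And>n U. U \<in> upsets s \<Longrightarrow> measure (M n) U \<le> measure (M (Suc n)) U"
    and x0: "x0 \<in> C"
    and tight: "\<And>e::real. e > 0 \<Longrightarrow> \<exists>t\<ge>0. \<forall>n. measure (M n) {y\<in>C. D x0 y > t} \<le> e"
    and A: "A \<in> ring s" and e: "(e::real) > 0"
  shows "\<exists>B\<in>ring s. \<exists>Q. compact Q \<and> B \<subseteq> Q \<and> Q \<subseteq> A \<and> lim (\<lambda>n. measure (M n) (A - B)) \<le> e"
  using A e
proof (induction arbitrary: e rule: ring_induct)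
  case empty
  then show ?case using upsets_subset_ring upsets_empty
    by (intro bexI[of _ "{}"] exI[of _ "{}"]) auto
next
  case (Un A B)
  interpret R: ring_of_sets C "ring s" by (rule ring_of_sets_ring)
  obtain A' Q where A': "A' \<in> ring s" "compact Q" "A' \<subseteq> Q" "Q \<subseteq> A" "lim (\<lambda>n. measure (M n) (A - A')) \<le> e / 2"
    using Un.IH(1)[of "e / 2"] Un.prems by auto
  obtain B' Q' where B': "B' \<in> ring s" "compact Q'" "B' \<subseteq> Q'" "Q' \<subseteq> B" "lim (\<lambda>n. measure (M n) (B - B')) \<le> e / 2"
    using Un.IH(2)[of "e / 2"] Un.prems by auto
  have conv: "(\<lambda>n. measure (M n) A) \<longlonglongrightarrow> lim (\<lambda>n. measure (M n) A)" if "A \<in> ring s" for A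
    using ring_convergent[where M=M, OF M mono that] by (simp add: convergent_LIMSEQ_iff)
  have "lim (\<lambda>n. measure (M n) (A \<union> B - (A' \<union> B')))
      \<le> lim (\<lambda>n. measure (M n) (A - A')) + lim (\<lambda>n. measure (M n) (B - B'))"
  proof (rule LIMSEQ_le[OF conv tendsto_add[OF conv conv]])
    show "A \<union> B - (A' \<union> B') \<in> ring s" "A - A' \<in> ring s" "B - B' \<in> ring s"
      using Un A' B' by auto
    have "measure (M n) (A \<union> B - (A' \<union> B')) \<le> measure (M n) (A - A') + measure (M n) (B - B')" for n
    proof -
      interpret prob_space "M n" by (rule borel_probD(1)[OF M])
      have [simp]: "sets (M n) = sets N" by (rule borel_probD[OF M])
      have [simp]: "A \<in> sets N" "B \<in> sets N" "A' \<in> sets N" "B' \<in> sets N"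
        using Un A' B' ring_sets by auto
      have "measure (M n) (A \<union> B - (A' \<union> B')) \<le> measure (M n) ((A - A') \<union> (B - B'))"
        by (intro finite_measure_mono) (auto intro!: sets.Un sets.Diff)
      also have "\<dots> \<le> measure (M n) (A - A') + measure (M n) (B - B')"
        by (intro measure_Un_le) auto
      finally show ?thesis .
    qed
    then show "\<exists>N. \<forall>n\<ge>N. measure (M n) (A \<union> B - (A' \<union> B')) \<le> measure (M n) (A - A') + measure (M n) (B - B')"
      by blast
  qed
  then show ?case using A' B'
    by (intro bexI[of _ "A' \<union> B'"] exI[of _ "Q \<union> Q'"]) (auto intro: compact_Un)
next
  case (diff U V)
  interpret R: ring_of_sets C "ring s" by (rule ring_of_sets_ring)
  let ?g = "\<lambda>A. lim (\<lambda>n. measure (M n) A)"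
  have conv: "(\<lambda>n. measure (M n) A) \<longlonglongrightarrow> ?g A" if "A \<in> ring s" for A
    using ring_convergent[where M=M, OF M mono that] by (simp add: convergent_LIMSEQ_iff)
  have le_g: "measure (M n) W \<le> ?g W" if "W \<in> upsets s" for n W
  proof (rule incseq_le)
    show "incseq (\<lambda>n. measure (M n) W)" using mono[OF that] by (rule incseq_SucI)
    show "(\<lambda>n. measure (M n) W) \<longlonglongrightarrow> ?g W" using that upsets_subset_ring conv by blast
  qed
  obtain F :: "nat \<Rightarrow> 'a set" where F: "incseq F" "(\<Union>k. F k) = U"
    "\<And>k. F k \<in> upsets s" "\<And>k. closure (F k) \<inter> C \<subseteq> U"
    using upsets_inner_approximation[OF s diff(1)] by auto
  have Fr: "F k \<in> ring s" "U \<in> ring s" "V \<in> ring s" for k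
    using F(3) diff upsets_subset_ring by auto
  \<comment> \<open>The limits in \<open>n\<close> and \<open>k\<close> are interchanged: fix
    \<open>n\<close> first, then choose \<open>k\<close> for that one measure. Since masses of
    up-sets increase in \<open>n\<close>, \<open>?g (F k)\<close> is at least
    \<open>measure (M n) (F k)\<close>.\<close>
  have "\<forall>\<^sub>F n in sequentially. measure (M n) U > ?g U - e / 4"
    using order_tendstoD(1)[OF conv[OF Fr(2)]] diff.prems by simp
  then obtain n where n: "measure (M n) U > ?g U - e / 4" by (auto simp: eventually_sequentially)
  have "(\<lambda>k. measure (M n) (F k)) \<longlonglongrightarrow> measure (M n) U"
  proof -
    interpret prob_space "M n" by (rule borel_probD(1)[OF M])
    show ?thesis
      using finite_Lim_measure_incseq[of F] F upsets_sets[OF F(3)] borel_probD(2)[OF M[of n]] by auto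
  qed
  then have "\<forall>\<^sub>F k in sequentially. measure (M n) (F k) > measure (M n) U - e / 4"
    using order_tendstoD(1) diff.prems by fastforce
  then obtain k where "measure (M n) (F k) > measure (M n) U - e / 4"
    by (auto simp: eventually_sequentially)
  then have k: "?g U - ?g (F k) \<le> e / 2" using n le_g[OF F(3), of n k] by linarith
  obtain t where t: "t \<ge> 0" "\<And>n. measure (M n) {y\<in>C. D x0 y > t} \<le> e / 2"
    using tight[of "e / 2"] diff.prems by auto
  \<comment> \<open>A cell belongs to the ring, a closed ball is compact, so each serves its own
    set. With radius \<open>t + 1\<close> a point outside the cell has distance greater than
    \<open>t\<close>, and the tail bound applies.\<close>
  let ?B = "(F k - V) \<inter> cell s x0 (t + 1)" and ?Q = "(closure (F k) \<inter> - V) \<inter> {y\<in>C. D x0 y \<le> t + 1}"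
  have B: "?B \<in> ring s" by (intro R.Int R.Diff Fr cell_in_ring)
  have "compact ?Q"
    using thompson_compact[OF x0, of "t + 1"] t upsets_open[OF diff(2)]
    by (intro closed_Int_compact closed_Int) auto
  moreover have "?B \<subseteq> ?Q"
    using closure_subset[of "F k"] upsets_subset[OF F(3)[of k]] cell_subset_ball[OF s x0, of "t + 1"] t by auto
  moreover have "?Q \<subseteq> U - V" using F(4)[of k] by blast
  moreover have "?g (U - V - ?B) \<le> ?g U - ?g (F k) + e / 2"
  proof (rule LIMSEQ_le[OF conv tendsto_add[OF tendsto_diff[OF conv conv] tendsto_const]])
    show "U - V - ?B \<in> ring s" using Fr B by (intro R.Diff) auto
    have "measure (M n) (U - V - ?B) \<le> measure (M n) U - measure (M n) (F k) + e / 2" for n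
    proof -
      interpret prob_space "M n" by (rule borel_probD(1)[OF M])
      have [simp]: "sets (M n) = sets N" by (rule borel_probD[OF M])
      have [simp]: "F k \<in> sets N" "U \<in> sets N" "V \<in> sets N" using Fr ring_sets by auto
      have [simp]: "{y\<in>C. D x0 y > t} \<in> sets N"
        using borel_measurable_less[OF measurable_const thompson_measurable_right[OF x0], of t] by simp
      have "U - V - ?B \<subseteq> (U - F k) \<union> {y\<in>C. D x0 y > t}"
      proof
        fix y assume y: "y \<in> U - V - ?B"
        then have "y \<in> C" using upsets_subset[OF diff(1)] by blast
        then show "y \<in> (U - F k) \<union> {y\<in>C. D x0 y > t}"
          using y ball_subset_cell[OF s x0, of y "t + 1"] by force
      qed
      then have "measure (M n) (U - V - ?B) \<le> measure (M n) ((U - F k) \<union> {y\<in>C. D x0 y > t})"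
        by (intro finite_measure_mono) (auto intro!: sets.Un sets.Diff)
      also have "\<dots> \<le> measure (M n) (U - F k) + measure (M n) {y\<in>C. D x0 y > t}"
        by (intro measure_Un_le) auto
      also have "measure (M n) (U - F k) = measure (M n) U - measure (M n) (F k)"
        using F(2) by (intro finite_measure_Diff) auto
      finally show ?thesis using t(2)[of n] by linarith
    qed
    then show "\<exists>N. \<forall>n\<ge>N. measure (M n) (U - V - ?B) \<le> measure (M n) U - measure (M n) (F k) + e / 2"
      by blast
  qed (use Fr in auto)
  ultimately show ?case using B k by (intro bexI[OF _ B] exI[of _ ?Q]) auto
qed

text \<open>The extension theorem asks only for continuity at the empty set. This is a compact-class
  argument: compact subsets of ring sets that decrease to the empty set have an empty intersection
  after finitely many terms.\<close>

lemma limit_measure: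
  fixes M :: "nat \<Rightarrow> 'a measure"
  assumes s: "s = 1 \<or> s = -1" and M: "\<And>n. M n \<in> borel_prob C"
    and mono: "\<And>n U. U \<in> upsets s \<Longrightarrow> measure (M n) U \<le> measure (M (Suc n)) U"
    and x0: "x0 \<in> C"
    and tight: "\<And>e::real. e > 0 \<Longrightarrow> \<exists>t\<ge>0. \<forall>n. measure (M n) {y\<in>C. D x0 y > t} \<le> e"
  shows "\<exists>\<mu>\<in>borel_prob C. \<forall>U\<in>upsets s. (\<lambda>n. measure (M n) U) \<longlonglongrightarrow> measure \<mu> U"
proof -
  interpret R: ring_of_sets C "ring s" by (rule ring_of_sets_ring)
  define g where "g A = lim (\<lambda>n. measure (M n) A)" for A
  have conv: "(\<lambda>n. measure (M n) A) \<longlonglongrightarrow> g A" if "A \<in> ring s" for A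
    using ring_convergent[where M=M, OF M mono that] by (simp add: convergent_LIMSEQ_iff g_def)
  have g_nonneg: "g A \<ge> 0" if "A \<in> ring s" for A
    by (rule LIMSEQ_le_const[OF conv[OF that]]) auto
  have g_empty: "g {} = 0" by (simp add: g_def)
  have meas: "prob_space (M n)" "sets (M n) = sets N" "space (M n) = C" for n
    using borel_probD[OF M] by auto
  have g_add: "g (A \<union> B) = g A + g B" if "A \<in> ring s" "B \<in> ring s" "A \<inter> B = {}" for A B
  proof (rule LIMSEQ_unique[OF conv])
    show "A \<union> B \<in> ring s" using that by auto
    have "measure (M n) (A \<union> B) = measure (M n) A + measure (M n) B" for n
    proof -
      interpret prob_space "M n" by (rule meas)
      show ?thesis using finite_measure_Union[of A B] that ring_sets meas(2) by auto
    qed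
    then show "(\<lambda>n. measure (M n) (A \<union> B)) \<longlonglongrightarrow> g A + g B"
      using tendsto_add[OF conv conv] that by simp
  qed
  have g_mono: "g A \<le> g B" if "A \<in> ring s" "B \<in> ring s" "A \<subseteq> B" for A B
  proof -
    have "g B = g (A \<union> (B - A))" using that by (simp add: Un_absorb1)
    also have "\<dots> = g A + g (B - A)" using that by (intro g_add) auto
    finally show ?thesis using g_nonneg[of "B - A"] that by auto
  qed
  have g_sub: "g A \<le> (\<Sum>i\<le>n. g (B i))" if "A \<in> ring s" "\<And>i. B i \<in> ring s" "A \<subseteq> (\<Union>i\<le>n. B i)"
    for A B and n :: nat
  proof (rule LIMSEQ_le[OF conv[OF that(1)] tendsto_sum[OF conv[OF that(2)]]])
    have "measure (M m) A \<le> (\<Sum>i\<le>n. measure (M m) (B i))" for m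
    proof -
      interpret prob_space "M m" by (rule meas)
      have "measure (M m) A \<le> measure (M m) (\<Union>i\<le>n. B i)"
        using that ring_sets meas(2) by (intro finite_measure_mono sets.finite_UN) auto
      also have "\<dots> \<le> (\<Sum>i\<le>n. measure (M m) (B i))"
        using that ring_sets meas(2) by (intro measure_UNION_le) auto
      finally show ?thesis .
    qed
    then show "\<exists>N. \<forall>m\<ge>N. measure (M m) A \<le> (\<Sum>i\<le>n. measure (M m) (B i))" by blast
  qed
  have cont: "(\<lambda>i. g (A i)) \<longlonglongrightarrow> 0"
    if A: "range A \<subseteq> ring s" "decseq A" "(\<Inter>i. A i) = {}" for A :: "nat \<Rightarrow> 'a set"
  proof (rule LIMSEQ_I)
    fix e :: real assume e: "e > 0"
    have Ar: "A i \<in> ring s" for i using A(1) by blast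
    \<comment> \<open>The geometric errors sum to less than \<open>e\<close>.\<close>
    have "\<exists>B Q. B \<in> ring s \<and> compact Q \<and> B \<subseteq> Q \<and> Q \<subseteq> A i \<and> g (A i - B) \<le> e * (1/2) ^ (i + 2)" for i
    proof -
      have pos: "e * (1/2) ^ (i + 2) > 0" using e by simp
      have "\<exists>B\<in>ring s. \<exists>Q. compact Q \<and> B \<subseteq> Q \<and> Q \<subseteq> A i \<and> lim (\<lambda>n. measure (M n) (A i - B)) \<le> e * (1/2) ^ (i + 2)"
        by (rule ring_inner_compact[where M=M and A="A i", OF s _ _ x0 _ Ar pos]) (fact M mono tight)+
      then show ?thesis
        unfolding g_def by (elim bexE exE conjE, intro exI conjI)
    qed
    then have "\<forall>i. \<exists>B Q. B \<in> ring s \<and> compact Q \<and> B \<subseteq> Q \<and> Q \<subseteq> A i \<and> g (A i - B) \<le> e * (1/2) ^ (i + 2)"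
      by (rule allI)
    from choice[OF this] obtain B where
      "\<forall>i. \<exists>Q. B i \<in> ring s \<and> compact Q \<and> B i \<subseteq> Q \<and> Q \<subseteq> A i \<and> g (A i - B i) \<le> e * (1/2) ^ (i + 2)"
      by (rule exE)
    from choice[OF this] obtain Q where
      BQ_all: "\<forall>i. B i \<in> ring s \<and> compact (Q i) \<and> B i \<subseteq> Q i \<and> Q i \<subseteq> A i \<and> g (A i - B i) \<le> e * (1/2) ^ (i + 2)"
      by (rule exE)
    note BQ = BQ_all[rule_format, THEN conjunct1]
      BQ_all[rule_format, THEN conjunct2, THEN conjunct1]
      BQ_all[rule_format, THEN conjunct2, THEN conjunct2, THEN conjunct1]
      BQ_all[rule_format, THEN conjunct2, THEN conjunct2, THEN conjunct2, THEN conjunct1]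
      BQ_all[rule_format, THEN conjunct2, THEN conjunct2, THEN conjunct2, THEN conjunct2]
    define Q' where "Q' n = (\<Inter>i\<le>n. Q i)" for n
    have "\<exists>n. Q' n = {}"
    proof (rule ccontr)
      assume "\<not> ?thesis"
      then have ne: "\<And>n. Q' n \<noteq> {}" by blast
      have "\<Inter>(range Q') \<noteq> {}"
      proof (rule compact_nest[OF _ ne])
        show "compact (Q' n)" for n
        proof -
          have "closed (Q' n)" unfolding Q'_def using BQ(2) by (intro closed_INT ballI compact_imp_closed)
          moreover have "Q' n = Q 0 \<inter> Q' n" by (auto simp: Q'_def)
          ultimately show ?thesis using compact_Int_closed[OF BQ(2)] by metis
        qed
        show "Q' n \<subseteq> Q' m" if "m \<le> n" for m n using that by (auto simp: Q'_def)
      qed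
      then obtain y where "\<And>n. y \<in> Q' n" by blast
      then have "\<And>n. y \<in> A n" using BQ(4) by (force simp: Q'_def)
      then show False using A(3) by blast
    qed
    then obtain n where n: "Q' n = {}" by blast
    \<comment> \<open>Since the compact sets up to \<open>n\<close> have no common point, each point
      of \<open>A n\<close> misses some \<open>Q i\<close>, hence \<open>B i\<close>; thus the
      approximation errors alone cover \<open>A n\<close>.\<close>
    have "A n \<subseteq> (\<Union>i\<le>n. A i - B i)"
    proof
      fix y assume y: "y \<in> A n"
      then obtain i where "i \<le> n" "y \<notin> Q i" using n by (auto simp: Q'_def)
      then show "y \<in> (\<Union>i\<le>n. A i - B i)"
        using BQ(3) y decseqD[OF A(2), of i n] by blast
    qed
    then have "g (A n) \<le> (\<Sum>i\<le>n. g (A i - B i))"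
      using Ar BQ(1) by (intro g_sub) auto
    also have "\<dots> \<le> (\<Sum>i\<le>n. e * (1/2) ^ (i + 2))" by (intro sum_mono BQ)
    also have "\<dots> = e * (1/2 - (1/2) ^ (n + 2))"
    proof -
      have "(\<Sum>i\<le>n. (1/2::real) ^ (i + 2)) = 1/2 - (1/2) ^ (n + 2)"
        by (induction n) (auto simp: field_simps)
      then show ?thesis by (simp only: sum_distrib_left[symmetric])
    qed
    also have "\<dots> < e * 1"
    proof (rule mult_strict_left_mono[OF _ e])
      have "(1/2::real) ^ (n + 2) > 0" by simp
      then show "1/2 - (1/2::real) ^ (n + 2) < 1" by linarith
    qed
    finally have "g (A n) < e" by simp
    then have "norm (g (A m) - 0) < e" if "m \<ge> n" for m
      using g_mono[OF Ar Ar decseqD[OF A(2) that]] g_nonneg[OF Ar, of m] by simp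
    then show "\<exists>no. \<forall>n\<ge>no. norm (g (A n) - 0) < e" by blast
  qed
  have "\<exists>\<mu> :: 'a set \<Rightarrow> ennreal. (\<forall>A \<in> ring s. \<mu> A = ennreal (g A)) \<and> measure_space C (sigma_sets C (ring s)) \<mu>"
  proof (rule R.caratheodory_empty_continuous)
    show "positive (ring s) (\<lambda>A. ennreal (g A))" by (simp add: positive_def g_empty)
    show "additive (ring s) (\<lambda>A. ennreal (g A))"
      unfolding additive_def using g_add g_nonneg by (simp add: ennreal_plus)
    show "(\<lambda>i. ennreal (g (A i))) \<longlonglongrightarrow> 0"
      if "range A \<subseteq> ring s" "decseq A" "(\<Inter>i. A i) = {}" for A
      using tendsto_ennrealI[OF cont[OF that]] by simp
  qed simp
  then obtain m0 :: "'a set \<Rightarrow> ennreal" where m0: "\<And>A. A \<in> ring s \<Longrightarrow> m0 A = ennreal (g A)"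
    "measure_space C (sets N) m0"
    unfolding sets_N_eq_sigma_ring[OF s] by blast
  define \<mu> where "\<mu> = measure_of C (sets N) m0"
  have sigma: "sigma_algebra C (sets N)" using m0(2) by (simp add: measure_space_def)
  have sets_mu: "sets \<mu> = sets N"
    unfolding \<mu>_def using sigma by (simp add: sigma_algebra.sets_measure_of_eq)
  have em: "emeasure \<mu> A = m0 A" if "A \<in> sets N" for A
    unfolding \<mu>_def using m0(2) that
    by (intro emeasure_measure_of_sigma) (auto simp: measure_space_def)
  have meas_mu: "measure \<mu> A = g A" if "A \<in> ring s" for A
    using em[OF ring_sets[OF that]] m0(1)[OF that] g_nonneg[OF that] by (simp add: measure_def)
  have C_ring: "C \<in> ring s" using upsets_C upsets_subset_ring by blast
  have "g C = 1"
  proof -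
    have "measure (M n) C = 1" for n using prob_space.prob_space[OF meas(1)[of n]] meas(3) by simp
    then show ?thesis by (simp add: g_def)
  qed
  moreover have "space \<mu> = C" using sets_eq_imp_space_eq[OF sets_mu] by simp
  ultimately have "emeasure \<mu> (space \<mu>) = 1"
    using em[OF ring_sets[OF C_ring]] m0(1)[OF C_ring] by simp
  then have "\<mu> \<in> borel_prob C" by (auto simp: borel_prob_def sets_mu intro: prob_spaceI)
  moreover have "(\<lambda>n. measure (M n) U) \<longlonglongrightarrow> measure \<mu> U" if "U \<in> upsets s" for U
  proof -
    have "U \<in> ring s" using that upsets_subset_ring[of s] by blast
    then show ?thesis using conv[of U] meas_mu[of U] by simp
  qed
  ultimately show ?thesis by blast
qed

subsection \<open>Wasserstein convergence\<close>

text \<open>Couplings are Borel measures on the product, whereas \<open>partition_coupling\<close>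
  produces one on the product sigma-algebra.\<close>

lemma sets_N_pair: "sets (N \<Otimes>\<^sub>M N) = sets (restrict_space borel (C \<times> C))"
proof
  have CC: "C \<times> C \<in> sets borel" using C_open by (intro borel_open open_Times)
  show "sets (N \<Otimes>\<^sub>M N) \<subseteq> sets (restrict_space borel (C \<times> C))"
    unfolding sets_pair_measure
  proof (rule sets.sigma_sets_subset'[where M = "restrict_space borel (C \<times> C)" for M])
    show "{a \<times> b |a b. a \<in> sets N \<and> b \<in> sets N} \<subseteq> sets (restrict_space borel (C \<times> C))"
    proof safe
      fix a b assume "a \<in> sets N" "b \<in> sets N"
      then have "a \<times> b \<subseteq> C \<times> C" "a \<times> b \<in> sets (borel \<Otimes>\<^sub>M borel)" by (auto simp: sets_N)
      then have "a \<times> b \<subseteq> C \<times> C" "a \<times> b \<in> sets borel" unfolding borel_prod by blast+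
      then show "a \<times> b \<in> sets (restrict_space borel (C \<times> C))"
        using CC by (subst sets_restrict_space_iff) auto
    qed
    show "space N \<times> space N \<in> sets (restrict_space borel (C \<times> C))"
      using CC by (subst sets_restrict_space_iff) auto
  qed
  show "sets (restrict_space borel (C \<times> C)) \<subseteq> sets (N \<Otimes>\<^sub>M N)"
  proof
    fix X assume "X \<in> sets (restrict_space borel (C \<times> C))"
    moreover have "X \<in> sets (restrict_space borel (C \<times> C)) \<longleftrightarrow> X \<subseteq> C \<times> C \<and> X \<in> sets borel"
      using CC by (intro sets_restrict_space_iff) simp
    ultimately have X: "X \<subseteq> C \<times> C" "X \<in> sets (borel \<Otimes>\<^sub>M borel)"
      unfolding borel_prod by blast+
    have id: "(\<lambda>x. x) \<in> measurable N borel" by (intro measurable_restrict_space1) simp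
    have "(\<lambda>z. (fst z, snd z)) \<in> measurable (N \<Otimes>\<^sub>M N) (borel \<Otimes>\<^sub>M borel)"
      using measurable_compose[OF measurable_fst id] measurable_compose[OF measurable_snd id]
      by (intro measurable_Pair) auto
    from measurable_sets[OF this X(2)] have "X \<inter> space (N \<Otimes>\<^sub>M N) \<in> sets (N \<Otimes>\<^sub>M N)" by simp
    moreover have "X \<inter> space (N \<Otimes>\<^sub>M N) = X" using X(1) by (auto simp: space_pair_measure)
    ultimately show "X \<in> sets (N \<Otimes>\<^sub>M N)" by simp
  qed
qed

section \<open>Uniform control of moment tails\<close>

text \<open>The threshold \<open>-1\<close> recovers the full moment on \<open>C\<close>, since
  distances there are nonnegative.\<close>

definition tail_cost :: "real \<Rightarrow> 'a \<Rightarrow> real \<Rightarrow> 'a \<Rightarrow> real" where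
  "tail_cost p x0 r y = D x0 y powr p * indicator {y. D x0 y > r} y"

lemma tail_cost_measurable: "x0 \<in> C \<Longrightarrow> tail_cost p x0 r \<in> borel_measurable N"
proof -
  assume "x0 \<in> C"
  then have [measurable]: "D x0 \<in> borel_measurable N" by (rule thompson_measurable_right)
  have "tail_cost p x0 r = (\<lambda>y. if D x0 y > r then D x0 y powr p else 0)"
    by (auto simp: tail_cost_def indicator_def)
  then show ?thesis by simp
qed

lemma measurable_borel_prob: "m \<in> borel_prob C \<Longrightarrow> f \<in> borel_measurable N \<Longrightarrow> f \<in> borel_measurable m"
  using borel_probD(2) by (simp cong: measurable_cong_sets)

text \<open>Every superlevel set of the truncated cost is the outside of a Thompson ball, so
  \<open>thompson_tail_le\<close> can be integrated over the levels.\<close>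

lemma tail_cost_le:
  assumes m: "m1 \<in> borel_prob C" "m \<in> borel_prob C" "m2 \<in> borel_prob C"
    and le: "stoch_le C m1 m" "stoch_le C m m2" and x: "x0 \<in> C" and p: "p > 0"
  shows "(\<integral>\<^sup>+y. ennreal (tail_cost p x0 r y) \<partial>m) \<le>
    (\<integral>\<^sup>+y. ennreal (tail_cost p x0 r y) \<partial>m1) + (\<integral>\<^sup>+y. ennreal (tail_cost p x0 r y) \<partial>m2)"
proof -
  let ?f = "tail_cost p x0 r"
  have layer: "(\<integral>\<^sup>+y. ennreal (?f y) \<partial>m') = (\<integral>\<^sup>+t. emeasure m' {y\<in>C. ?f y > t} * indicator {0..} t \<partial>lborel)"
    if "m' \<in> borel_prob C" for m'
  proof -
    interpret prob_space m' by (rule borel_probD(1)[OF that])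
    show ?thesis
      using nn_integral_layer_cake[OF sigma_finite_measure_axioms measurable_borel_prob[OF that tail_cost_measurable[OF x]]]
      by (simp add: borel_probD(3)[OF that])
  qed
  have meas: "(\<lambda>t. emeasure m' {y\<in>C. ?f y > t}) \<in> borel_measurable lborel"
    if "m' \<in> borel_prob C" for m'
  proof -
    interpret prob_space m' by (rule borel_probD(1)[OF that])
    have [measurable]: "?f \<in> borel_measurable m'"
      by (rule measurable_borel_prob[OF that tail_cost_measurable[OF x]])
    have "(\<lambda>t. emeasure m' {y\<in>space m'. ?f y > t}) \<in> borel_measurable lborel" by measurable
    then show ?thesis by (simp add: borel_probD(3)[OF that])
  qed
  have "emeasure m {y\<in>C. ?f y > t} \<le> emeasure m1 {y\<in>C. ?f y > t} + emeasure m2 {y\<in>C. ?f y > t}"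
    if t: "t \<ge> 0" for t
  proof -
    \<comment> \<open>The second entry inverts the power; the first is the cutoff of the indicator.
      As \<open>t\<close> is nonnegative, points where the cost is cut to 0 do not count.\<close>
    let ?q = "max r (t powr (1 / p))"
    have *: "D x0 y powr p > t \<longleftrightarrow> D x0 y > t powr (1 / p)" if "y \<in> C" for y
    proof -
      have D: "D x0 y \<ge> 0" using thompson_nonneg x that by simp
      have "t powr (1 / p) < D x0 y \<longleftrightarrow> (t powr (1 / p)) powr p < D x0 y powr p"
        using D p by (metis less_eq_real_def linorder_not_less powr_ge_zero powr_less_mono2 powr_mono2)
      then show ?thesis using t p by (simp add: powr_powr)
    qed
    have "{y\<in>C. ?f y > t} = {y\<in>C. D x0 y > ?q}"
      using * t by (auto simp: tail_cost_def indicator_def)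
    moreover have "measure m {y\<in>C. D x0 y > ?q} \<le> measure m1 {y\<in>C. D x0 y > ?q} + measure m2 {y\<in>C. D x0 y > ?q}"
      by (rule thompson_tail_le[OF m le x]) (simp add: le_max_iff_disj)
    moreover have "emeasure m' A = ennreal (measure m' A)" if "m' \<in> borel_prob C" for m' A
      using prob_space.finite_measure[OF borel_probD(1)[OF that]] by (rule finite_measure.emeasure_eq_measure)
    ultimately show ?thesis using m by (simp add: ennreal_plus[symmetric] ennreal_leI del: ennreal_plus)
  qed
  then have "(\<integral>\<^sup>+y. ennreal (?f y) \<partial>m) \<le> (\<integral>\<^sup>+t. emeasure m1 {y\<in>C. ?f y > t} * indicator {0..} t
      + emeasure m2 {y\<in>C. ?f y > t} * indicator {0..} t \<partial>lborel)"
    unfolding layer[OF m(2)] by (intro nn_integral_mono) (auto simp: indicator_def)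
  also have "\<dots> = (\<integral>\<^sup>+y. ennreal (?f y) \<partial>m1) + (\<integral>\<^sup>+y. ennreal (?f y) \<partial>m2)"
    unfolding layer[OF m(1)] layer[OF m(3)] using meas[OF m(1)] meas[OF m(3)]
    by (intro nn_integral_add borel_measurable_times) auto
  finally show ?thesis .
qed

text \<open>\<open>borel_prob_p\<close> provides a finite moment at one base point; the triangle
  inequality moves it to any other.\<close>

lemma borel_prob_p_moment:
  assumes m: "m \<in> borel_prob_p p C" and x0: "x0 \<in> C" and p: "p > 0"
  shows "(\<integral>\<^sup>+y. ennreal (D x0 y powr p) \<partial>m) < \<infinity>"
proof -
  obtain x where x: "x \<in> C" "(\<integral>\<^sup>+y. ennreal (D x y powr p) \<partial>m) < \<infinity>" and mb: "m \<in> borel_prob C"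
    using m by (auto simp: borel_prob_p_def)
  interpret prob_space m by (rule borel_probD(1)[OF mb])
  have [measurable]: "D x \<in> borel_measurable m"
    by (rule measurable_borel_prob[OF mb thompson_measurable_right[OF x(1)]])
  have "(\<integral>\<^sup>+y. ennreal (D x0 y powr p) \<partial>m)
      \<le> (\<integral>\<^sup>+y. ennreal (2 powr p * D x0 x powr p) + ennreal (2 powr p) * ennreal (D x y powr p) \<partial>m)"
  proof (intro nn_integral_mono)
    fix y assume "y \<in> space m"
    then have y: "y \<in> C" using borel_probD(3)[OF mb] by simp
    have "D x0 y powr p \<le> (D x0 x + D x y) powr p"
      using thompson_triangle[OF x0 x(1) y] thompson_nonneg[OF x0 y] p by (intro powr_mono2) auto
    also have "\<dots> \<le> 2 powr p * D x0 x powr p + 2 powr p * D x y powr p"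
      using thompson_nonneg[OF x0 x(1)] thompson_nonneg[OF x(1) y] p by (intro powr_add_le) auto
    finally show "ennreal (D x0 y powr p) \<le> ennreal (2 powr p * D x0 x powr p) + ennreal (2 powr p) * ennreal (D x y powr p)"
      by (simp add: ennreal_mult[symmetric] ennreal_plus[symmetric] ennreal_leI del: ennreal_plus)
  qed
  also have "\<dots> = ennreal (2 powr p * D x0 x powr p) + ennreal (2 powr p) * (\<integral>\<^sup>+y. ennreal (D x y powr p) \<partial>m)"
    by (subst nn_integral_add) (auto simp: nn_integral_cmult emeasure_space_1)
  also have "\<dots> < \<infinity>" using x(2) by (simp add: ennreal_mult_less_top)
  finally show ?thesis .
qed

lemma tail_cost_tendsto_0:
  assumes m: "m \<in> borel_prob_p p C" and x0: "x0 \<in> C" and p: "p > 0"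
  shows "(\<lambda>k::nat. \<integral>\<^sup>+y. ennreal (tail_cost p x0 (real k) y) \<partial>m) \<longlonglongrightarrow> 0"
proof -
  have mb: "m \<in> borel_prob C" using m by (simp add: borel_prob_p_def)
  have [measurable]: "D x0 \<in> borel_measurable m"
    by (rule measurable_borel_prob[OF mb thompson_measurable_right[OF x0]])
  have "(\<lambda>k::nat. \<integral>\<^sup>+y. ennreal (tail_cost p x0 (real k) y) \<partial>m) \<longlonglongrightarrow> (\<integral>\<^sup>+y. 0 \<partial>m)"
  proof (rule nn_integral_dominated_convergence[where w = "\<lambda>y. ennreal (D x0 y powr p)"])
    show "(\<lambda>y. ennreal (tail_cost p x0 (real k) y)) \<in> borel_measurable m" for k
      using measurable_borel_prob[OF mb tail_cost_measurable[OF x0]] by measurable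
    show "AE y in m. ennreal (tail_cost p x0 (real k) y) \<le> ennreal (D x0 y powr p)" for k
      by (auto simp: tail_cost_def indicator_def intro!: AE_I2 ennreal_leI)
    show "(\<integral>\<^sup>+y. ennreal (D x0 y powr p) \<partial>m) < \<infinity>" by (rule borel_prob_p_moment[OF m x0 p])
    show "AE y in m. (\<lambda>k. ennreal (tail_cost p x0 (real k) y)) \<longlonglongrightarrow> 0"
    proof (intro AE_I2 tendsto_eventually)
      fix y
      obtain n :: nat where "D x0 y \<le> real n" using real_arch_simple by blast
      then show "\<forall>\<^sub>F k in sequentially. ennreal (tail_cost p x0 (real k) y) = 0"
        by (intro eventually_sequentiallyI[of n]) (auto simp: tail_cost_def indicator_def)
    qed
  qed measurable
  then show ?thesis by simp
qed

text \<open>The bound \<open>r \<ge> 1\<close> is requested so that the cost is at least 1 on the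
  tail; small tail cost then also means small tail mass, which is the tightness used for the limit
  measure.\<close>

lemma tail_cost_uniform:
  assumes m: "m1 \<in> borel_prob_p p C" "m2 \<in> borel_prob_p p C" and x0: "x0 \<in> C" and p: "p > 0"
    and e: "(e::real) > 0"
  shows "\<exists>r\<ge>1. \<forall>m\<in>borel_prob C. stoch_le C m1 m \<longrightarrow> stoch_le C m m2 \<longrightarrow>
    (\<integral>\<^sup>+y. ennreal (tail_cost p x0 r y) \<partial>m) \<le> ennreal e"
proof -
  have mb: "m1 \<in> borel_prob C" "m2 \<in> borel_prob C" using m by (auto simp: borel_prob_p_def)
  have "(\<lambda>k::nat. (\<integral>\<^sup>+y. ennreal (tail_cost p x0 (real k) y) \<partial>m1)
      + (\<integral>\<^sup>+y. ennreal (tail_cost p x0 (real k) y) \<partial>m2)) \<longlonglongrightarrow> 0 + 0"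
    using m x0 p by (intro tendsto_add tail_cost_tendsto_0)
  then have "\<forall>\<^sub>F k in sequentially. (\<integral>\<^sup>+y. ennreal (tail_cost p x0 (real k) y) \<partial>m1)
      + (\<integral>\<^sup>+y. ennreal (tail_cost p x0 (real k) y) \<partial>m2) < ennreal e"
    using e by (intro order_tendstoD(2)) auto
  then have "\<forall>\<^sub>F k in sequentially. (\<integral>\<^sup>+y. ennreal (tail_cost p x0 (real k) y) \<partial>m1)
      + (\<integral>\<^sup>+y. ennreal (tail_cost p x0 (real k) y) \<partial>m2) < ennreal e \<and> k \<ge> 1"
    using eventually_ge_at_top by (intro eventually_conj)
  then obtain k :: nat where k: "(\<integral>\<^sup>+y. ennreal (tail_cost p x0 (real k) y) \<partial>m1)
      + (\<integral>\<^sup>+y. ennreal (tail_cost p x0 (real k) y) \<partial>m2) < ennreal e" "k \<ge> 1"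
    by (auto simp: eventually_sequentially)
  show ?thesis
  proof (intro exI[of _ "real k"] conjI ballI impI)
    fix m' assume "m' \<in> borel_prob C" "stoch_le C m1 m'" "stoch_le C m' m2"
    then show "(\<integral>\<^sup>+y. ennreal (tail_cost p x0 (real k) y) \<partial>m') \<le> ennreal e"
      using tail_cost_le[OF mb(1) _ mb(2) _ _ x0 p, of m' "real k"] k(1) by auto
  qed (use k in auto)
qed

section \<open>Cell partitions and vanishing transport cost\<close>

text \<open>The centres are enumerated by natural numbers so that \<open>disjointed\<close> can turn
  the cover into a partition.\<close>

lemma finite_cell_cover:
  assumes s: "s = 1 \<or> s = -1" and x0: "x0 \<in> C" and r: "r \<ge> 0" and d: "d > 0"
  shows "\<exists>(n::nat) f. (\<forall>i<n. f i \<in> C \<and> D x0 (f i) \<le> r) \<and> {y\<in>C. D x0 y \<le> r} \<subseteq> (\<Union>i<n. cell s (f i) d)"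
proof -
  let ?Q = "{y\<in>C. D x0 y \<le> r}"
  have "\<forall>x\<in>?Q. \<exists>O'. open O' \<and> x \<in> O' \<and> O' \<subseteq> cell s x d" using cell_nbhd[OF s _ d] by blast
  then obtain O' where O': "\<forall>x\<in>?Q. open (O' x) \<and> x \<in> O' x \<and> O' x \<subseteq> cell s x d"
    using bchoice[of ?Q "\<lambda>x O'. open O' \<and> x \<in> O' \<and> O' \<subseteq> cell s x d"] by blast
  then have "\<And>x. x \<in> ?Q \<Longrightarrow> open (O' x)" "?Q \<subseteq> (\<Union>x\<in>?Q. O' x)" by blast+
  then obtain X where X: "X \<subseteq> ?Q" "finite X" "?Q \<subseteq> (\<Union>x\<in>X. O' x)"
    by (rule compactE_image[OF thompson_compact[OF x0 r]])
  obtain n :: nat and f where f: "X = f ` {i. i < n}"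
    using finite_imp_nat_seg_image_inj_on[OF X(2)] by blast
  show ?thesis
  proof (intro exI[of _ n] exI[of _ f] conjI)
    show "\<forall>i<n. f i \<in> C \<and> D x0 (f i) \<le> r" using X(1) f by auto
    have "(\<Union>x\<in>X. O' x) \<subseteq> (\<Union>x\<in>X. cell s x d)"
      using X(1) O' by (intro UN_mono) auto
    also have "\<dots> = (\<Union>i<n. cell s (f i) d)" using f by auto
    finally show "?Q \<subseteq> (\<Union>i<n. cell s (f i) d)" using X(3) by (rule order_trans[rotated])
  qed
qed

lemma wasserstein_le:
  assumes \<pi>: "\<pi> \<in> couplings C m m'" and b: "b \<ge> 0" and p: "p > 0"
    and le: "(\<integral>\<^sup>+z. ennreal (D (fst z) (snd z) powr p) \<partial>\<pi>) \<le> ennreal b"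
  shows "wasserstein_dist p C m m' \<le> b powr (1 / p)"
proof -
  have "(INF \<pi>\<in>couplings C m m'. \<integral>\<^sup>+z. ennreal (D (fst z) (snd z) powr p) \<partial>\<pi>) \<le> ennreal b"
    using le by (rule INF_lower2[OF \<pi>])
  then have "enn2real (INF \<pi>\<in>couplings C m m'. \<integral>\<^sup>+z. ennreal (D (fst z) (snd z) powr p) \<partial>\<pi>) \<le> b"
    using b by (metis enn2real_ennreal enn2real_mono ennreal_less_top)
  then show ?thesis unfolding wasserstein_dist_def using p by (intro powr_mono2) auto
qed

text \<open>The cost budget \<eta> is split into a third for pairs sharing a cell and, for each of
  the two marginals, a sixth for the mismatch of cell masses and a sixth for the tail.\<close>

lemma wasserstein_tendsto_0:
  fixes M :: "nat \<Rightarrow> 'a measure"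
  assumes s: "s = 1 \<or> s = -1" and M: "\<And>n. M n \<in> borel_prob C" and m: "m \<in> borel_prob C"
    and lim: "\<And>U. U \<in> upsets s \<Longrightarrow> (\<lambda>n. measure (M n) U) \<longlonglongrightarrow> measure m U"
    and x0: "x0 \<in> C" and p: "p > 0"
    and tail: "\<And>e::real. e > 0 \<Longrightarrow> \<exists>r\<ge>1. (\<integral>\<^sup>+y. ennreal (tail_cost p x0 r y) \<partial>m) \<le> ennreal e \<and>
        (\<forall>n. (\<integral>\<^sup>+y. ennreal (tail_cost p x0 r y) \<partial>M n) \<le> ennreal e)"
  shows "(\<lambda>n. wasserstein_dist p C (M n) m) \<longlonglongrightarrow> 0"
proof (rule LIMSEQ_I)
  fix \<epsilon> :: real assume eps: "\<epsilon> > 0"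
  \<comment> \<open>Half of \<epsilon>, because the resulting bound on the distance is not
    strict.\<close>
  define \<eta> where "\<eta> = (\<epsilon> / 2) powr p"
  have eta: "\<eta> > 0" using eps by (simp add: \<eta>_def)
  \<comment> \<open>Two points of a cell are within \<open>2 * d\<close> of each other;
    \<open>d\<close> makes the corresponding cost one third of the budget.\<close>
  define d where "d = (\<eta> / 3) powr (1 / p) / 2"
  have d: "d > 0" using eta by (simp add: d_def)
  have d2: "(2 * d) powr p = \<eta> / 3" using eta p by (simp add: d_def powr_powr)
  \<comment> \<open>The tail is weighted by \<open>2 powr p\<close>, and the product is to be one
    sixth of the budget.\<close>
  define e' where "e' = \<eta> / (6 * 2 powr p)"
  have e': "e' > 0" using eta by (simp add: e'_def)
  obtain r where r: "r \<ge> 1" "(\<integral>\<^sup>+y. ennreal (tail_cost p x0 r y) \<partial>m) \<le> ennreal e'"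
    "\<And>n. (\<integral>\<^sup>+y. ennreal (tail_cost p x0 r y) \<partial>M n) \<le> ennreal e'"
    using tail[OF e'] by auto
  obtain k :: nat and f where f: "\<And>i. i < k \<Longrightarrow> f i \<in> C" "\<And>i. i < k \<Longrightarrow> D x0 (f i) \<le> r"
    and cover: "{y\<in>C. D x0 y \<le> r} \<subseteq> (\<Union>i<k. cell s (f i) d)"
    using finite_cell_cover[OF s x0 _ d, of r] r(1) by auto
  interpret R: ring_of_sets C "ring s" by (rule ring_of_sets_ring)
  \<comment> \<open>Disjointing uses only ring operations, so the masses of the pieces still
    converge.\<close>
  define A where "A = disjointed (\<lambda>i. cell s (f i) d)"
  have A_ring: "A i \<in> ring s" for i
    unfolding A_def disjointed_def using cell_in_ring by (intro R.Diff R.finite_UN) auto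
  have A_cell: "A i \<subseteq> cell s (f i) d" for i by (auto simp: A_def disjointed_def)
  have A_dist: "y \<in> C \<and> D (f i) y \<le> d" if "i < k" "y \<in> A i" for i y
    using cell_subset_ball[OF s f(1)[OF that(1)] less_imp_le[OF d]] A_cell that(2) by (auto simp: cell_def)
  have UA: "(\<Union>i<k. A i) = (\<Union>i<k. cell s (f i) d)"
    using finite_UN_disjointed_eq[of "\<lambda>i. cell s (f i) d" k] by (simp add: A_def atLeast0LessThan)
  define \<Delta> where "\<Delta> n = (\<Sum>i<k. \<bar>measure (M n) (A i) - measure m (A i)\<bar>)" for n
  have "(\<lambda>n. \<Delta> n) \<longlonglongrightarrow> (\<Sum>i<k. \<bar>measure m (A i) - measure m (A i)\<bar>)"
    unfolding \<Delta>_def using ring_LIMSEQ[OF M m lim A_ring] by (intro tendsto_intros)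
  then have Delta: "\<Delta> \<longlonglongrightarrow> 0" by simp
  \<comment> \<open>Centres lie within \<open>r\<close> of \<open>x0\<close> and cells within
    \<open>d\<close> of their centres, so \<open>R\<close> bounds the weight
    \<open>2 powr p * D x0 y powr p\<close> on all cells.\<close>
  define R where "R = 2 powr p * (r + d) powr p"
  have R: "R > 0" using r d by (simp add: R_def)
  have "(\<lambda>n. R * \<Delta> n) \<longlonglongrightarrow> R * 0" by (intro tendsto_intros Delta)
  then have "\<forall>\<^sub>F n in sequentially. R * \<Delta> n < \<eta> / 6"
    using eta by (intro order_tendstoD(2)) auto
  then obtain n0 where n0: "\<And>n. n \<ge> n0 \<Longrightarrow> R * \<Delta> n < \<eta> / 6" by (auto simp: eventually_sequentially)
  \<comment> \<open>By the triangle inequality through \<open>x0\<close> and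
    \<open>powr_add_le\<close>, the cost of a pair is at most the sum of the weights of its two
    points.\<close>
  let ?\<phi> = "\<lambda>y. ennreal (2 powr p * D x0 y powr p)"
  let ?c = "\<lambda>z. ennreal (D (fst z) (snd z) powr p)"
  have rest: "(\<integral>\<^sup>+x. ?\<phi> x * indicator (space m' - (\<Union>i<k. A i)) x \<partial>m') \<le> ennreal (\<eta> / 6)"
    if m': "m' \<in> borel_prob C" "(\<integral>\<^sup>+y. ennreal (tail_cost p x0 r y) \<partial>m') \<le> ennreal e'" for m'
  proof -
    have [measurable]: "tail_cost p x0 r \<in> borel_measurable m'"
      by (rule measurable_borel_prob[OF m'(1) tail_cost_measurable[OF x0]])
    have "(\<integral>\<^sup>+x. ?\<phi> x * indicator (space m' - (\<Union>i<k. A i)) x \<partial>m')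
        \<le> (\<integral>\<^sup>+x. ennreal (2 powr p) * ennreal (tail_cost p x0 r x) \<partial>m')"
    proof (intro nn_integral_mono)
      fix x assume "x \<in> space m'"
      then have x: "x \<in> C" using borel_probD(3)[OF m'(1)] by simp
      have "D x0 x > r" if "x \<notin> (\<Union>i<k. A i)" using cover x that unfolding UA by force
      then show "?\<phi> x * indicator (space m' - (\<Union>i<k. A i)) x \<le> ennreal (2 powr p) * ennreal (tail_cost p x0 r x)"
        by (auto simp: indicator_def tail_cost_def ennreal_mult)
    qed
    also have "\<dots> = ennreal (2 powr p) * (\<integral>\<^sup>+x. ennreal (tail_cost p x0 r x) \<partial>m')"
      by (intro nn_integral_cmult) measurable
    also have "\<dots> \<le> ennreal (2 powr p) * ennreal e'" by (intro mult_left_mono m') simp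
    also have "\<dots> = ennreal (\<eta> / 6)" using e' by (simp add: ennreal_mult[symmetric] e'_def)
    finally show ?thesis .
  qed
  have "norm (wasserstein_dist p C (M n) m - 0) < \<epsilon>" if n: "n \<ge> n0" for n
  proof -
    have sets_Mm: "sets (M n \<Otimes>\<^sub>M m) = sets (N \<Otimes>\<^sub>M N)"
      using borel_probD(2)[OF M[of n]] borel_probD(2)[OF m] by (rule sets_pair_measure_cong)
    interpret P: partition_pair "M n" m "{..<k}" A
    proof (rule partition_pair.intro)
      show "disjoint_family_on A {..<k}"
        unfolding A_def using disjoint_family_disjointed by (rule disjoint_family_on_mono[rotated]) simp
      show "A i \<in> sets (M n)" for i using ring_sets[OF A_ring] borel_probD(2)[OF M] by simp
    qed (use borel_probD[OF M] borel_probD[OF m] in auto)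
    have "\<exists>\<pi>. prob_space \<pi> \<and> sets \<pi> = sets (M n \<Otimes>\<^sub>M m) \<and> distr \<pi> (M n) fst = M n \<and> distr \<pi> m snd = m \<and>
      (\<integral>\<^sup>+z. ?c z \<partial>\<pi>) \<le> ennreal (\<eta> / 3)
      + (ennreal R * ennreal (\<Delta> n) + (\<integral>\<^sup>+x. ?\<phi> x * indicator (space (M n) - (\<Union>i<k. A i)) x \<partial>M n))
      + (ennreal R * ennreal (\<Delta> n) + (\<integral>\<^sup>+x. ?\<phi> x * indicator (space (M n) - (\<Union>i<k. A i)) x \<partial>m))"
      unfolding \<Delta>_def
    proof (rule P.partition_coupling)
      have [measurable]: "(\<lambda>z. D (fst z) (snd z)) \<in> borel_measurable (M n \<Otimes>\<^sub>M m)"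
        using thompson_measurable by (simp cong: measurable_cong_sets add: measurable_cong_sets[OF sets_Mm refl])
      show "?c \<in> borel_measurable (M n \<Otimes>\<^sub>M m)" by measurable
      have [measurable]: "D x0 \<in> borel_measurable (M n)"
        by (rule measurable_borel_prob[OF M thompson_measurable_right[OF x0]])
      show "?\<phi> \<in> borel_measurable (M n)" by measurable
    next
      fix i x y assume i: "i \<in> {..<k}" "x \<in> A i" "y \<in> A i"
      then have xy: "x \<in> C" "D (f i) x \<le> d" "y \<in> C" "D (f i) y \<le> d" using A_dist[of i] by auto
      have "D x y \<le> D x (f i) + D (f i) y" using xy f(1) i by (intro thompson_triangle) auto
      then have "D x y \<le> 2 * d" using xy thompson_sym[of x "f i"] by simp
      then have "D x y powr p \<le> (2 * d) powr p"
        using thompson_nonneg xy p by (intro powr_mono2) auto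
      then show "?c (x, y) \<le> ennreal (\<eta> / 3)" by (simp add: d2 ennreal_leI)
    next
      fix x y assume "x \<in> space (M n)" "y \<in> space (M n)"
      then have xy: "x \<in> C" "y \<in> C" using borel_probD(3)[OF M] by auto
      have "D x y powr p \<le> (D x0 x + D x0 y) powr p"
        using thompson_triangle[OF xy(1) x0 xy(2)] thompson_sym[of x x0] thompson_nonneg[OF xy] p
        by (intro powr_mono2) auto
      also have "\<dots> \<le> 2 powr p * D x0 x powr p + 2 powr p * D x0 y powr p"
        using thompson_nonneg[OF x0] xy p by (intro powr_add_le) auto
      finally show "?c (x, y) \<le> ?\<phi> x + ?\<phi> y"
        by (simp add: ennreal_plus[symmetric] ennreal_leI del: ennreal_plus)
    next
      fix i x assume i: "i \<in> {..<k}" "x \<in> A i"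
      then have x: "x \<in> C" "D (f i) x \<le> d" using A_dist[of i] by auto
      have "D x0 x \<le> D x0 (f i) + D (f i) x" using x f(1) i x0 by (intro thompson_triangle) auto
      also have "\<dots> \<le> r + d" using x f(2) i by (intro add_mono) auto
      finally show "?\<phi> x \<le> ennreal R"
        unfolding R_def using thompson_nonneg[OF x0 x(1)] p
        by (intro ennreal_leI mult_left_mono powr_mono2) auto
    qed
    then obtain \<pi> where \<pi>: "prob_space \<pi>" "sets \<pi> = sets (M n \<Otimes>\<^sub>M m)" "distr \<pi> (M n) fst = M n"
      "distr \<pi> m snd = m"
      and cost: "(\<integral>\<^sup>+z. ?c z \<partial>\<pi>) \<le> ennreal (\<eta> / 3)
      + (ennreal R * ennreal (\<Delta> n) + (\<integral>\<^sup>+x. ?\<phi> x * indicator (space (M n) - (\<Union>i<k. A i)) x \<partial>M n))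
      + (ennreal R * ennreal (\<Delta> n) + (\<integral>\<^sup>+x. ?\<phi> x * indicator (space (M n) - (\<Union>i<k. A i)) x \<partial>m))"
      by blast
    have "\<pi> \<in> couplings C (M n) m"
    proof -
      have "distr \<pi> N fst = distr \<pi> (M n) fst" "distr \<pi> N snd = distr \<pi> m snd"
        using borel_probD(2)[OF M[of n]] borel_probD(2)[OF m] by (auto intro: distr_cong)
      then show ?thesis
        using \<pi> sets_Mm sets_N_pair by (simp add: couplings_def borel_prob_def)
    qed
    moreover have "(\<integral>\<^sup>+z. ?c z \<partial>\<pi>) \<le> ennreal \<eta>"
    proof -
      have D0: "\<Delta> n \<ge> 0" by (auto simp: \<Delta>_def intro: sum_nonneg)
      have "ennreal R * ennreal (\<Delta> n) \<le> ennreal (\<eta> / 6)"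
        using n0[OF n] R D0 by (simp add: ennreal_mult[symmetric] ennreal_leI)
      moreover have "space (M n) = space m" using borel_probD(3)[OF M] borel_probD(3)[OF m] by simp
      ultimately have "(\<integral>\<^sup>+z. ?c z \<partial>\<pi>) \<le> ennreal (\<eta> / 3) + (ennreal (\<eta> / 6) + ennreal (\<eta> / 6))
          + (ennreal (\<eta> / 6) + ennreal (\<eta> / 6))"
        using rest[OF M r(3)[of n]] rest[OF m r(2)]
        by (intro order_trans[OF cost] add_mono order_refl) auto
      also have "\<dots> = ennreal \<eta>" using eta by (simp add: ennreal_plus[symmetric] del: ennreal_plus)
      finally show ?thesis .
    qed
    ultimately have "wasserstein_dist p C (M n) m \<le> \<eta> powr (1 / p)"
      using eta p by (intro wasserstein_le) auto
    also have "\<dots> = \<epsilon> / 2" using eps p by (simp add: \<eta>_def powr_powr)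
    finally have "wasserstein_dist p C (M n) m \<le> \<epsilon> / 2" .
    moreover have "wasserstein_dist p C (M n) m \<ge> 0" by (simp add: wasserstein_dist_def)
    ultimately show ?thesis using eps by simp
  qed
  then show "\<exists>n0. \<forall>n\<ge>n0. norm (wasserstein_dist p C (M n) m - 0) < \<epsilon>" by blast
qed

section \<open>Limits in the stochastic order and the theorem\<close>

lemma stoch_le_iff_1: "stoch_le C m m' \<longleftrightarrow> (\<forall>U\<in>upsets 1. measure m U \<le> measure m' U)"
  by (auto simp: stoch_le_def upsets_1)

lemma stoch_le_iff_minus_1:
  assumes "m \<in> borel_prob C" "m' \<in> borel_prob C"
  shows "stoch_le C m m' \<longleftrightarrow> (\<forall>U\<in>upsets (-1). measure m' U \<le> measure m U)"
proof
  assume "stoch_le C m m'"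
  then show "\<forall>U\<in>upsets (-1). measure m' U \<le> measure m U"
    using upsets_reverse[of 1 m m'] assms by (auto simp: stoch_le_iff_1)
next
  assume "\<forall>U\<in>upsets (-1). measure m' U \<le> measure m U"
  then show "stoch_le C m m'"
    using upsets_reverse[of "-1" m' m] assms by (auto simp: stoch_le_iff_1)
qed

text \<open>The order is read on the family where masses are known to converge, upper or lower sets
  according to \<open>s\<close>. Comparison from index \<open>k\<close> on is enough, which is all
  that a monotone sequence offers for its term \<open>M k\<close>.\<close>

lemma stoch_le_limit:
  fixes M :: "nat \<Rightarrow> 'a measure"
  assumes s: "s = 1 \<or> s = -1" and M: "\<And>n. M n \<in> borel_prob C" and \<mu>: "\<mu> \<in> borel_prob C"
    and lim: "\<And>U. U \<in> upsets s \<Longrightarrow> (\<lambda>n. measure (M n) U) \<longlonglongrightarrow> measure \<mu> U"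
    and m: "m \<in> borel_prob C"
  shows "(\<And>n. n \<ge> k \<Longrightarrow> stoch_le C m (M n)) \<Longrightarrow> stoch_le C m \<mu>"
    and "(\<And>n. n \<ge> k \<Longrightarrow> stoch_le C (M n) m) \<Longrightarrow> stoch_le C \<mu> m"
proof -
  show "stoch_le C m \<mu>" if le: "\<And>n. n \<ge> k \<Longrightarrow> stoch_le C m (M n)"
    using s
  proof
    assume "s = 1"
    then show ?thesis
      using le unfolding stoch_le_iff_1 by (auto intro!: LIMSEQ_le_const[OF lim])
  next
    assume "s = -1"
    then show ?thesis
      using le unfolding stoch_le_iff_minus_1[OF m M] stoch_le_iff_minus_1[OF m \<mu>]
      by (auto intro!: LIMSEQ_le_const2[OF lim])
  qed
  show "stoch_le C \<mu> m" if le: "\<And>n. n \<ge> k \<Longrightarrow> stoch_le C (M n) m"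
    using s
  proof
    assume "s = 1"
    then show ?thesis
      using le unfolding stoch_le_iff_1 by (auto intro!: LIMSEQ_le_const2[OF lim])
  next
    assume "s = -1"
    then show ?thesis
      using le unfolding stoch_le_iff_minus_1[OF M m] stoch_le_iff_minus_1[OF \<mu> m]
      by (auto intro!: LIMSEQ_le_const[OF lim])
  qed
qed

text \<open>Bounds on both sides are needed for the tails; in the theorem one is \<nu> and the other
  the first term of the sequence.\<close>

lemma monotone_bounded_limit:
  fixes M :: "nat \<Rightarrow> 'a measure"
  assumes s: "s = 1 \<or> s = -1" and p: "p > 0" and M: "\<And>n. M n \<in> borel_prob_p p C"
    and mono: "\<And>n U. U \<in> upsets s \<Longrightarrow> measure (M n) U \<le> measure (M (Suc n)) U"
    and m: "m1 \<in> borel_prob_p p C" "m2 \<in> borel_prob_p p C"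
    and le: "\<And>n. stoch_le C m1 (M n)" "\<And>n. stoch_le C (M n) m2"
  shows "\<exists>\<mu>\<in>borel_prob_p p C. stoch_le C m1 \<mu> \<and> stoch_le C \<mu> m2 \<and>
    (\<forall>U\<in>upsets s. (\<lambda>n. measure (M n) U) \<longlonglongrightarrow> measure \<mu> U) \<and>
    (\<lambda>n. wasserstein_dist p C (M n) \<mu>) \<longlonglongrightarrow> 0"
proof -
  obtain x0 where x0: "x0 \<in> C" using C_nonempty by blast
  have Mb: "M n \<in> borel_prob C" for n using M by (simp add: borel_prob_p_def)
  have mb: "m1 \<in> borel_prob C" "m2 \<in> borel_prob C" using m by (auto simp: borel_prob_p_def)
  have tight: "\<exists>t\<ge>0. \<forall>n. measure (M n) {y\<in>C. D x0 y > t} \<le> e" if e: "e > 0" for e :: real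
  proof -
    obtain r where r: "r \<ge> 1" and tail: "\<And>n. (\<integral>\<^sup>+y. ennreal (tail_cost p x0 r y) \<partial>M n) \<le> ennreal e"
      using tail_cost_uniform[OF m x0 p e] Mb le by blast
    have "measure (M n) {y\<in>C. D x0 y > r} \<le> e" for n
    proof -
      interpret prob_space "M n" by (rule borel_probD(1)[OF Mb])
      have [measurable]: "D x0 \<in> borel_measurable (M n)"
        by (rule measurable_borel_prob[OF Mb thompson_measurable_right[OF x0]])
      have "{y\<in>space (M n). D x0 y > r} \<in> sets (M n)" by measurable
      then have sets: "{y\<in>C. D x0 y > r} \<in> sets (M n)" by (simp add: borel_probD(3)[OF Mb])
      have "emeasure (M n) {y\<in>C. D x0 y > r} = (\<integral>\<^sup>+y. indicator {y\<in>C. D x0 y > r} y \<partial>M n)"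
        using sets by simp
      also have "\<dots> \<le> (\<integral>\<^sup>+y. ennreal (tail_cost p x0 r y) \<partial>M n)"
      proof (intro nn_integral_mono)
        fix y
        \<comment> \<open>Markov's inequality in the form allowed by
          \<open>r \<ge> 1\<close>.\<close>
        have "1 \<le> D x0 y powr p" if "D x0 y > r" using that r p by (intro ge_one_powr_ge_zero) auto
        then show "indicator {y\<in>C. D x0 y > r} y \<le> ennreal (tail_cost p x0 r y)"
          by (auto simp: tail_cost_def indicator_def)
      qed
      also have "\<dots> \<le> ennreal e" by (rule tail)
      finally show ?thesis using e by (simp add: emeasure_eq_measure)
    qed
    then show ?thesis using r by (intro exI[of _ r]) auto
  qed
  obtain \<mu> where \<mu>: "\<mu> \<in> borel_prob C"
    and lim: "\<And>U. U \<in> upsets s \<Longrightarrow> (\<lambda>n. measure (M n) U) \<longlonglongrightarrow> measure \<mu> U"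
    using limit_measure[of s M x0, OF s Mb mono x0 tight] by blast
  have le_mu: "stoch_le C m1 \<mu>" "stoch_le C \<mu> m2"
    using stoch_le_limit[where M=M, OF s Mb \<mu> lim mb(1)] stoch_le_limit[where M=M, OF s Mb \<mu> lim mb(2)] le by blast+
  have "\<mu> \<in> borel_prob_p p C"
  proof -
    \<comment> \<open>With threshold \<open>-1\<close> nothing is cut off, so the tail comparison
      also bounds the full moment of the limit.\<close>
    have tc: "(\<integral>\<^sup>+y. ennreal (D x0 y powr p) \<partial>m') = (\<integral>\<^sup>+y. ennreal (tail_cost p x0 (-1) y) \<partial>m')"
      if "m' \<in> borel_prob C" for m'
    proof (rule nn_integral_cong)
      fix y assume "y \<in> space m'"
      then have "D x0 y \<ge> 0" using thompson_nonneg[OF x0] borel_probD(3)[OF that] by simp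
      then show "ennreal (D x0 y powr p) = ennreal (tail_cost p x0 (-1) y)" by (simp add: tail_cost_def)
    qed
    have "(\<integral>\<^sup>+y. ennreal (D x0 y powr p) \<partial>\<mu>) \<le> (\<integral>\<^sup>+y. ennreal (D x0 y powr p) \<partial>m1) + (\<integral>\<^sup>+y. ennreal (D x0 y powr p) \<partial>m2)"
      unfolding tc[OF \<mu>] tc[OF mb(1)] tc[OF mb(2)] by (rule tail_cost_le[OF mb(1) \<mu> mb(2) le_mu x0 p])
    also have "\<dots> < \<infinity>" using borel_prob_p_moment[OF m(1) x0 p] borel_prob_p_moment[OF m(2) x0 p] by simp
    finally show ?thesis using \<mu> x0 by (auto simp: borel_prob_p_def)
  qed
  moreover have "(\<lambda>n. wasserstein_dist p C (M n) \<mu>) \<longlonglongrightarrow> 0"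
  proof (rule wasserstein_tendsto_0[OF s Mb \<mu> lim x0 p])
    show "\<exists>r\<ge>1. (\<integral>\<^sup>+y. ennreal (tail_cost p x0 r y) \<partial>\<mu>) \<le> ennreal e \<and>
        (\<forall>n. (\<integral>\<^sup>+y. ennreal (tail_cost p x0 r y) \<partial>M n) \<le> ennreal e)" if "e > 0" for e :: real
      using tail_cost_uniform[OF m x0 p that] \<mu> le_mu Mb le by blast
  qed
  ultimately show ?thesis using le_mu lim by blast
qed

end

theorem proposition6p4:
  fixes C :: "'a::finite_dimensional_banach set"
    and p :: real
    and M :: "nat \<Rightarrow> 'a measure"
    and \<nu> :: "'a measure"
  assumes "open_cone C" and "proper_cone (closure C)"
    and "1 \<le> p"
    and "\<And>n. M n \<in> borel_prob_p p C" and "\<nu> \<in> borel_prob_p p C"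
  shows "((\<forall>n. stoch_le C (M n) (M (Suc n))) \<and> (\<forall>n. stoch_le C (M n) \<nu>) \<longrightarrow>
           (\<exists>\<mu>\<in>borel_prob_p p C. (\<forall>n. stoch_le C (M n) \<mu>) \<and> stoch_le C \<mu> \<nu> \<and>
              (\<lambda>n. wasserstein_dist p C (M n) \<mu>) \<longlonglongrightarrow> 0)) \<and>
         ((\<forall>n. stoch_le C (M (Suc n)) (M n)) \<and> (\<forall>n. stoch_le C \<nu> (M n)) \<longrightarrow>
           (\<exists>\<mu>\<in>borel_prob_p p C. (\<forall>n. stoch_le C \<mu> (M n)) \<and> stoch_le C \<nu> \<mu> \<and>
              (\<lambda>n. wasserstein_dist p C (M n) \<mu>) \<longlonglongrightarrow> 0))"
proof -
  interpret thompson_cone C using assms by unfold_locales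
  have p: "p > 0" using assms(3) by simp
  have Mb: "M n \<in> borel_prob C" for n using assms(4) by (simp add: borel_prob_p_def)
  have trans: "stoch_le C a b \<Longrightarrow> stoch_le C b c \<Longrightarrow> stoch_le C a c" for a b c :: "'a measure"
    unfolding stoch_le_def by (meson order_trans)
  have refl: "stoch_le C a a" for a :: "'a measure" by (simp add: stoch_le_def)
  show ?thesis
  proof (intro conjI impI; elim conjE)
    assume inc: "\<forall>n. stoch_le C (M n) (M (Suc n))" and b: "\<forall>n. stoch_le C (M n) \<nu>"
    have le: "stoch_le C (M k) (M n)" if "k \<le> n" for k n
      using that by (induction n rule: dec_induct) (use inc trans refl in blast)+
    \<comment> \<open>\<open>M 0\<close> serves as the lower end of the sandwich.\<close>
    obtain \<mu> where \<mu>: "\<mu> \<in> borel_prob_p p C" "stoch_le C \<mu> \<nu>"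
      "\<And>U. U \<in> upsets 1 \<Longrightarrow> (\<lambda>n. measure (M n) U) \<longlonglongrightarrow> measure \<mu> U"
      "(\<lambda>n. wasserstein_dist p C (M n) \<mu>) \<longlonglongrightarrow> 0"
      using monotone_bounded_limit[of 1 p M "M 0" \<nu>] p assms(4,5) inc b le
      by (auto simp: stoch_le_iff_1)
    moreover have "stoch_le C (M k) \<mu>" for k
      using \<mu>(1) le by (intro stoch_le_limit(1)[of 1 M \<mu> _ k] Mb \<mu>(3)) (auto simp: borel_prob_p_def)
    ultimately show "\<exists>\<mu>\<in>borel_prob_p p C. (\<forall>n. stoch_le C (M n) \<mu>) \<and> stoch_le C \<mu> \<nu> \<and>
      (\<lambda>n. wasserstein_dist p C (M n) \<mu>) \<longlonglongrightarrow> 0" by blast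
  next
    assume dec: "\<forall>n. stoch_le C (M (Suc n)) (M n)" and b: "\<forall>n. stoch_le C \<nu> (M n)"
    have le: "stoch_le C (M n) (M k)" if "k \<le> n" for k n
      using that by (induction n rule: dec_induct) (use dec trans refl in blast)+
    \<comment> \<open>Here masses increase on the open lower sets, and \<open>M 0\<close> is the
      upper end.\<close>
    obtain \<mu> where \<mu>: "\<mu> \<in> borel_prob_p p C" "stoch_le C \<nu> \<mu>"
      "\<And>U. U \<in> upsets (-1) \<Longrightarrow> (\<lambda>n. measure (M n) U) \<longlonglongrightarrow> measure \<mu> U"
      "(\<lambda>n. wasserstein_dist p C (M n) \<mu>) \<longlonglongrightarrow> 0"
      using monotone_bounded_limit[of "-1" p M \<nu> "M 0"] p assms(4,5) dec b le
      by (auto simp: stoch_le_iff_minus_1[OF Mb Mb])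
    moreover have "stoch_le C \<mu> (M k)" for k
      using \<mu>(1) le by (intro stoch_le_limit(2)[of "-1" M \<mu> _ k] Mb \<mu>(3)) (auto simp: borel_prob_p_def)
    ultimately show "\<exists>\<mu>\<in>borel_prob_p p C. (\<forall>n. stoch_le C \<mu> (M n)) \<and> stoch_le C \<nu> \<mu> \<and>
      (\<lambda>n. wasserstein_dist p C (M n) \<mu>) \<longlonglongrightarrow> 0" by blast
  qed
qed

end
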